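(* Let $R,S$ be punctual equivalence relations with $R<_{pr}S$. The interval $[R,S]$ of $\mathbf{Peq}$ embeds the diamond lattice preserving $0$ and $1$ if and only if $(R,S)$ has the black-lozenge property.
   Context: A punctual equivalence relation is a primitive recursive equivalence relation with domain $\omega$ having infinitely many equivalence classes. For equivalence relations $R,S$ on $\omega$, $R\leq_{pr} S$ means that there is a primitive recursive function $f:\omega\to\omega$ such that for all $x,y\in\omega$, $x\mathrel{R}y \Leftrightarrow f(x)\mathrel{S}f(y)$; $R<_{pr}S$ means $R\leq_{pr}S$ and $S\not\leq_{pr}R$; $R\equiv_{pr}S$ means $R\leq_{pr}S$ and $S\leq_{pr}R$. $\mathbf{Peq}$ is the partial order (in fact a lattice) of $\equiv_{pr}$-classes of punctual equivalence relations, ordered by the order induced by $\leq_{pr}$. For $X\subseteq\omega$, $R_X$ is given by $x\mathrel{R_X}y \Leftrightarrow (x,y\in X \text{ or } x=y)$; every punctual equivalence relation is $\equiv_{pr}$-equivalent to $R_X$ for some coinfinite primitive recursive $X$. The interval $[R,S]$ embeds the diamond lattice preserving $0$ and $1$ if there are punctual equivalence relations $T_0,T_1$ with $R<_{pr}T_i<_{pr}S$ for $i=0,1$ such that, in $\mathbf{Peq}$, the degree of $R$ is the meet and the degree of $S$ is the join of the degrees of $T_0$ and $T_1$. For a set $U$ let $\#(0^U)[s]$ be the number of $i\leq s$ with $i\notin U$. For punctual $R,S$, the pair $(R,S)$ has the black-lozenge property if there are primitive recursive, infinite and coinfinite sets $X^*,Y^*$ with $R_{X^*}\equiv_{pr}R$,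 $R_{Y^*}\equiv_{pr}S$ and $(\forall s)(\exists t\geq s)\,[\#(0^{X^*})[t]=\#(0^{Y^*})[t]]$. *)

theory Defs
  imports "HOL-Algebra.Order"
begin

section \<open>Primitive recursive functions, sets and relations\<close>

text \<open>\<open>primrec_fun n f\<close>: restricted to argument lists of length \<open>n\<close>, the function \<open>f\<close> is an
  \<open>n\<close>-ary primitive recursive function. Its values on lists of any other length carry no meaning
  and are never used. In the rule \<open>prec\<close> the recursion is on the first argument:
  \<open>h(0,x) = f(x)\<close> and \<open>h(k+1,x) = g(k,h(k,x),x)\<close>.\<close>

inductive primrec_fun :: "nat \<Rightarrow> (nat list \<Rightarrow> nat) \<Rightarrow> bool" where
  zero: "primrec_fun n (\<lambda>_. 0)"
| succ: "primrec_fun 1 (\<lambda>xs. Suc (xs ! 0))"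
| proj: "i < n \<Longrightarrow> primrec_fun n (\<lambda>xs. xs ! i)"
| comp: "primrec_fun (length gs) f \<Longrightarrow> \<forall>g\<in>set gs. primrec_fun n g \<Longrightarrow>
    primrec_fun n (\<lambda>xs. f (map (\<lambda>g. g xs) gs))"
| prec: "primrec_fun n f \<Longrightarrow> primrec_fun (n + 2) g \<Longrightarrow>
    primrec_fun (n + 1)
      (\<lambda>xs. rec_nat (f (tl xs)) (\<lambda>k r. g (k # r # tl xs)) (hd xs))"

definition primrec_unary :: "(nat \<Rightarrow> nat) \<Rightarrow> bool" where
  "primrec_unary f \<longleftrightarrow> (\<exists>g. primrec_fun 1 g \<and> (\<forall>x. f x = g [x]))"

definition primrec_set :: "nat set \<Rightarrow> bool" where
  "primrec_set X \<longleftrightarrow> primrec_unary (\<lambda>x. if x \<in> X then 1 else 0)"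

definition primrec_rel :: "nat rel \<Rightarrow> bool" where
  "primrec_rel R \<longleftrightarrow>
    (\<exists>g. primrec_fun 2 g \<and> (\<forall>x y. (if (x, y) \<in> R then 1 else 0) = g [x, y]))"


section \<open>Punctual equivalence relations and primitive recursive reducibility\<close>

definition punctual :: "nat rel \<Rightarrow> bool" where
  "punctual R \<longleftrightarrow> equiv UNIV R \<and> primrec_rel R \<and> infinite (UNIV // R)"

definition pr_le :: "nat rel \<Rightarrow> nat rel \<Rightarrow> bool" (infix \<open>\<le>\<^sub>p\<^sub>r\<close> 50) where
  "R \<le>\<^sub>p\<^sub>r S \<longleftrightarrow>
    (\<exists>f. primrec_unary f \<and> (\<forall>x y. (x, y) \<in> R \<longleftrightarrow> (f x, f y) \<in> S))"

definition pr_less :: "nat rel \<Rightarrow> nat rel \<Rightarrow> bool" (infix \<open><\<^sub>p\<^sub>r\<close> 50) where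
  "R <\<^sub>p\<^sub>r S \<longleftrightarrow> R \<le>\<^sub>p\<^sub>r S \<and> \<not> S \<le>\<^sub>p\<^sub>r R"

definition pr_equiv :: "nat rel \<Rightarrow> nat rel \<Rightarrow> bool" (infix \<open>\<equiv>\<^sub>p\<^sub>r\<close> 50) where
  "R \<equiv>\<^sub>p\<^sub>r S \<longleftrightarrow> R \<le>\<^sub>p\<^sub>r S \<and> S \<le>\<^sub>p\<^sub>r R"


section \<open>The degree structure\<close>

definition pr_degree :: "nat rel \<Rightarrow> nat rel set" where
  "pr_degree R = {S. punctual S \<and> R \<equiv>\<^sub>p\<^sub>r S}"

definition Peq :: "nat rel set gorder" where
  "Peq = \<lparr>carrier = pr_degree ` {R. punctual R}, eq = (=),
          le = (\<lambda>a b. \<exists>R\<in>a. \<exists>S\<in>b. R \<le>\<^sub>p\<^sub>r S)\<rparr>"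

lemma pr_le_refl: "R \<le>\<^sub>p\<^sub>r R"
  unfolding pr_le_def primrec_unary_def
  by (rule exI[of _ "\<lambda>x. x"]) (auto intro!: exI[of _ "\<lambda>xs. xs ! 0"] proj)

lemma primrec_unary_comp:
  assumes "primrec_unary f" "primrec_unary g"
  shows "primrec_unary (\<lambda>x. f (g x))"
proof -
  obtain f' g' where f': "primrec_fun 1 f'" "\<And>x. f x = f' [x]"
    and g': "primrec_fun 1 g'" "\<And>x. g x = g' [x]"
    using assms unfolding primrec_unary_def by blast
  have "primrec_fun 1 (\<lambda>xs. f' (map (\<lambda>g. g xs) [g']))"
    by (rule comp) (use f'(1) g'(1) in auto)
  then show ?thesis
    unfolding primrec_unary_def using f'(2) g'(2) by auto
qed

lemma pr_le_trans: "R \<le>\<^sub>p\<^sub>r S \<Longrightarrow> S \<le>\<^sub>p\<^sub>r T \<Longrightarrow> R \<le>\<^sub>p\<^sub>r T"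
  unfolding pr_le_def by (metis primrec_unary_comp)

lemma Peq_le_iff:
  assumes "punctual R" "punctual S"
  shows "pr_degree R \<sqsubseteq>\<^bsub>Peq\<^esub> pr_degree S \<longleftrightarrow> R \<le>\<^sub>p\<^sub>r S"
  using assms unfolding Peq_def pr_degree_def pr_equiv_def
  by (auto intro: pr_le_refl pr_le_trans)

lemma pr_degree_eq_iff:
  assumes "punctual R" "punctual S"
  shows "pr_degree R = pr_degree S \<longleftrightarrow> R \<equiv>\<^sub>p\<^sub>r S"
  using assms unfolding pr_degree_def pr_equiv_def
  by (auto intro: pr_le_refl pr_le_trans)

lemma carrier_Peq: "carrier Peq = pr_degree ` {R. punctual R}"
  by (simp add: Peq_def)

lemma eq_Peq: "eq Peq = (=)"
  by (simp add: Peq_def)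

lemma partial_order_Peq: "partial_order Peq"
proof -
  have antisym: "pr_degree R = pr_degree S"
    if "punctual R" "punctual S" "R \<le>\<^sub>p\<^sub>r S" "S \<le>\<^sub>p\<^sub>r R" for R S
    using that by (simp add: pr_degree_eq_iff pr_equiv_def)
  have trans: "pr_degree R \<sqsubseteq>\<^bsub>Peq\<^esub> pr_degree T"
    if "punctual R" "punctual S" "punctual T"
      "pr_degree R \<sqsubseteq>\<^bsub>Peq\<^esub> pr_degree S" "pr_degree S \<sqsubseteq>\<^bsub>Peq\<^esub> pr_degree T" for R S T
    using that pr_le_trans[of R S T] by (simp add: Peq_le_iff)
  show ?thesis
  proof unfold_locales
    fix a b c assume "a \<in> carrier Peq" "b \<in> carrier Peq" "c \<in> carrier Peq"
    then show "a \<sqsubseteq>\<^bsub>Peq\<^esub> b \<Longrightarrow> b \<sqsubseteq>\<^bsub>Peq\<^esub> c \<Longrightarrow> a \<sqsubseteq>\<^bsub>Peq\<^esub> c"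
      unfolding carrier_Peq using trans by blast
  next
    fix a b assume "a \<in> carrier Peq" "b \<in> carrier Peq"
      "a \<sqsubseteq>\<^bsub>Peq\<^esub> b" "b \<sqsubseteq>\<^bsub>Peq\<^esub> a"
    then show "a .=\<^bsub>Peq\<^esub> b"
      unfolding carrier_Peq eq_Peq using antisym Peq_le_iff by blast
  next
    fix a assume "a \<in> carrier Peq"
    then show "a \<sqsubseteq>\<^bsub>Peq\<^esub> a"
      unfolding carrier_Peq using Peq_le_iff pr_le_refl by blast
  qed (simp_all add: eq_Peq)
qed

definition is_meet :: "('a, 'b) gorder_scheme \<Rightarrow> 'a \<Rightarrow> 'a \<Rightarrow> 'a \<Rightarrow> bool" where
  "is_meet L m a b \<longleftrightarrow> greatest L m (Lower L {a, b})"

definition is_join :: "('a, 'b) gorder_scheme \<Rightarrow> 'a \<Rightarrow> 'a \<Rightarrow> 'a \<Rightarrow> bool" where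
  "is_join L j a b \<longleftrightarrow> least L j (Upper L {a, b})"

definition embeds_diamond_preserving_0_1 :: "nat rel \<Rightarrow> nat rel \<Rightarrow> bool" where
  "embeds_diamond_preserving_0_1 R S \<longleftrightarrow>
    (\<exists>T\<^sub>0 T\<^sub>1. punctual T\<^sub>0 \<and> punctual T\<^sub>1 \<and>
      R <\<^sub>p\<^sub>r T\<^sub>0 \<and> T\<^sub>0 <\<^sub>p\<^sub>r S \<and> R <\<^sub>p\<^sub>r T\<^sub>1 \<and> T\<^sub>1 <\<^sub>p\<^sub>r S \<and>
      is_meet Peq (pr_degree R) (pr_degree T\<^sub>0) (pr_degree T\<^sub>1) \<and>
      is_join Peq (pr_degree S) (pr_degree T\<^sub>0) (pr_degree T\<^sub>1))"


section \<open>The black-lozenge property\<close>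

definition set_rel :: "nat set \<Rightarrow> nat rel" where
  "set_rel X = {(x, y). (x \<in> X \<and> y \<in> X) \<or> x = y}"

definition count_zeros :: "nat set \<Rightarrow> nat \<Rightarrow> nat" where
  "count_zeros U s = card {i. i \<le> s \<and> i \<notin> U}"

definition black_lozenge :: "nat rel \<Rightarrow> nat rel \<Rightarrow> bool" where
  "black_lozenge R S \<longleftrightarrow>
    (\<exists>X Y. primrec_set X \<and> infinite X \<and> infinite (- X) \<and>
           primrec_set Y \<and> infinite Y \<and> infinite (- Y) \<and>
           set_rel X \<equiv>\<^sub>p\<^sub>r R \<and> set_rel Y \<equiv>\<^sub>p\<^sub>r S \<and>
           (\<forall>s. \<exists>t\<ge>s. count_zeros X t = count_zeros Y t))"

end

theory Submission
  imports Defs "HOL-Library.Nat_Bijection"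
begin

text \<open>The degree of a punctual relation \<open>R\<close> depends only on how fast its classes appear. Let
\<open>num_classes R s\<close> be the number of classes that meet \<open>{0..s}\<close>. Then \<open>R \<le>\<^sub>p\<^sub>r S\<close> holds
exactly if \<open>num_classes R s \<le> num_classes S (h s)\<close> for some primitive recursive \<open>h\<close>
(\<open>pr_le_iff_counter_le\<close>): a reduction may send the \<open>k\<close>-th class of \<open>R\<close> to the \<open>k\<close>-th class
of \<open>S\<close>, and \<open>h\<close> says how far to search for it. The functions that arise as \<open>num_classes R\<close> are
the class counters: primitive recursive, unbounded, starting at \<open>1\<close> and growing in steps of \<open>0\<close> or
\<open>1\<close>. In this picture meets and joins of degrees are pointwise minima and maxima of counters.

Suppose \<open>T\<close> and \<open>U\<close> are the middle elements of a diamond, with counters \<open>t\<close> and \<open>u\<close>. They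
are incomparable, so neither \<open>t < u\<close> nor \<open>u < t\<close> holds from some point on. Since both
functions move in steps of at most \<open>1\<close>, they cannot overtake one another without being equal, and
so \<open>t = u\<close> infinitely often (\<open>incomparable_counters_meet\<close>). At these points
\<open>min t u\<close>, which represents \<open>R\<close>, equals \<open>max t u\<close>, which represents \<open>S\<close>. Reading the
two functions as zero counts of sets gives the black-lozenge property.

Conversely, the black-lozenge property yields counters \<open>r \<le> s\<close> for \<open>R\<close> and \<open>S\<close> that
agree infinitely often. Define two counters that at each argument take one of the values of \<open>r\<close> and
\<open>s\<close> each, exchanging the roles only at points where \<open>r = s\<close>. Their minimum is \<open>r\<close> and their
maximum is \<open>s\<close>, whatever the exchange points are. It remains to exchange so that \<open>s\<close> is reducible to
neither of them, and then both lie strictly between \<open>r\<close> and \<open>s\<close>. This is a diagonal argument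
against all primitive recursive bounds \<open>h\<close>. It suffices to treat the levels of a fast-growing
hierarchy \<open>fgh n\<close> that dominates them (\<open>fgh_dominates\<close>). While the counter in question
equals \<open>r\<close>, wait for some \<open>x\<close> with \<open>r (fgh n x) < s x\<close>. Such an \<open>x\<close> appears because
\<open>S \<le>\<^sub>p\<^sub>r R\<close> fails (\<open>stage_advances\<close>). The exchanges are themselves primitive recursive because
\<open>fgh\<close> is evaluated by a machine whose single steps are primitive recursive, and the
wait ends only once its computation has halted.\<close>

section \<open>Closure properties of the primitive recursive functions\<close>

text \<open>Functions of an environment \<open>e\<close>, in which \<open>e i\<close> is the value of the \<open>i\<close>-th variable. Since the
number of variables is existentially quantified, the closure rules below have no arity side
conditions. A construct that binds variables puts them in front and shifts the others, so that a
bound variable is again an entry of the environment and the rules apply under binders.\<close>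

definition PR :: "((nat \<Rightarrow> nat) \<Rightarrow> nat) \<Rightarrow> bool" where
  "PR f \<longleftrightarrow> (\<exists>n g. primrec_fun n g \<and> (\<forall>e. f e = g (map e [0..<n])))"

definition PRP :: "((nat \<Rightarrow> nat) \<Rightarrow> bool) \<Rightarrow> bool" where
  "PRP P \<longleftrightarrow> PR (\<lambda>e. of_bool (P e))"

lemma primrec_fun_pad:
  assumes "primrec_fun n g" "n \<le> m"
  shows "primrec_fun m (\<lambda>xs. g (map (\<lambda>i. xs ! i) [0..<n]))"
proof -
  have "primrec_fun m (\<lambda>xs. g (map (\<lambda>p. p xs) (map (\<lambda>i xs. xs ! i) [0..<n])))"
    using assms by (intro primrec_fun.comp) (auto intro: primrec_fun.proj)
  then show ?thesis by (simp add: o_def)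
qed

text \<open>Two functions can be composed only at a common arity, so each must be available at all large ones.\<close>

lemma PR_arity:
  assumes "PR f"
  obtains n where "\<And>m. n \<le> m \<Longrightarrow> \<exists>g. primrec_fun m g \<and> (\<forall>e. f e = g (map e [0..<m]))"
proof -
  obtain n g where g: "primrec_fun n g" "\<And>e. f e = g (map e [0..<n])"
    using assms unfolding PR_def by blast
  have "\<exists>g. primrec_fun m g \<and> (\<forall>e. f e = g (map e [0..<m]))" if "n \<le> m" for m
  proof (intro exI conjI allI)
    show "primrec_fun m (\<lambda>xs. g (map (\<lambda>i. xs ! i) [0..<n]))"
      using g(1) that by (rule primrec_fun_pad)
    fix e :: "nat \<Rightarrow> nat"
    have "map (\<lambda>i. map e [0..<m] ! i) [0..<n] = map e [0..<n]"
      using that by simp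
    then show "f e = g (map (\<lambda>i. map e [0..<m] ! i) [0..<n])"
      using g(2) by (metis (no_types))
  qed
  then show thesis using that by blast
qed

lemma PR_proj: "PR (\<lambda>e. e i)"
  unfolding PR_def
  by (rule exI[of _ "Suc i"], rule exI[of _ "\<lambda>xs. xs ! i"]) (auto intro: primrec_fun.proj simp: nth_append)

lemma PR_zero: "PR (\<lambda>e. 0)"
  unfolding PR_def using primrec_fun.zero by blast

text \<open>Only finitely many of the terms \<open>s i\<close> matter, and these have a common arity. Substitution reduces
closure under an operation to the case that its operands are variables.\<close>

lemma PR_subst:
  assumes f: "PR f" and s: "\<And>i. PR (s i)"
  shows "PR (\<lambda>e. f (\<lambda>i. s i e))"
proof -
  obtain n g where g: "primrec_fun n g" "\<And>e. f e = g (map e [0..<n])"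
    using f unfolding PR_def by blast
  have "\<exists>a. \<forall>i. \<forall>m\<ge>a i. \<exists>h. primrec_fun m h \<and> (\<forall>e. s i e = h (map e [0..<m]))"
    by (rule choice, rule allI, rule PR_arity[OF s]) blast
  then obtain a where a:
    "\<And>i m. a i \<le> m \<Longrightarrow> \<exists>h. primrec_fun m h \<and> (\<forall>e. s i e = h (map e [0..<m]))"
    by blast
  define m where "m = (\<Sum>i<n. a i)"
  have "a i \<le> m" if "i < n" for i
    unfolding m_def using that by (intro member_le_sum) auto
  then have "\<forall>i. \<exists>h. i < n \<longrightarrow> primrec_fun m h \<and> (\<forall>e. s i e = h (map e [0..<m]))"
    using a by blast
  then obtain h where h: "\<And>i. i < n \<Longrightarrow> primrec_fun m (h i) \<and> (\<forall>e. s i e = h i (map e [0..<m]))"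
    by metis
  have "primrec_fun m (\<lambda>xs. g (map (\<lambda>k. k xs) (map h [0..<n])))"
    using g(1) h by (intro primrec_fun.comp) auto
  moreover have "f (\<lambda>i. s i e) = g (map (\<lambda>k. k (map e [0..<m])) (map h [0..<n]))" for e
    unfolding g(2) using h by (auto intro!: arg_cong[of _ _ g])
  ultimately show ?thesis unfolding PR_def by blast
qed

lemma PR_subst1: "PR (\<lambda>e. f (e 0)) \<Longrightarrow> PR a \<Longrightarrow> PR (\<lambda>e. f (a e))"
  using PR_subst[of "\<lambda>e. f (e 0)" "\<lambda>_. a"] by simp

lemma PR_subst2:
  assumes "PR (\<lambda>e. f (e 0) (e 1))" "PR a" "PR b"
  shows "PR (\<lambda>e. f (a e) (b e))"
proof -
  have "PR (case i of 0 \<Rightarrow> a | Suc _ \<Rightarrow> b)" for i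
    using assms by (cases i) auto
  from PR_subst[of _ "\<lambda>i. case i of 0 \<Rightarrow> a | Suc _ \<Rightarrow> b", OF assms(1) this]
  show ?thesis by simp
qed

lemma PR_subst3:
  assumes "PR (\<lambda>e. f (e 0) (e 1) (e 2))" "PR a" "PR b" "PR c"
  shows "PR (\<lambda>e. f (a e) (b e) (c e))"
proof -
  have "PR (if i = 0 then a else if i = 1 then b else c)" for i
    using assms by auto
  from PR_subst[of _ "\<lambda>i. if i = 0 then a else if i = 1 then b else c", OF assms(1) this]
  show ?thesis by simp
qed

lemma PR_Suc:
  assumes "PR a"
  shows "PR (\<lambda>e. Suc (a e))"
proof (rule PR_subst1[OF _ assms])
  show "PR (\<lambda>e. Suc (e 0))"
    unfolding PR_def using primrec_fun.succ by (intro exI[of _ 1]) auto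
qed

text \<open>In the step function, variable \<open>0\<close> is the recursion counter and variable \<open>1\<close> the previous value.\<close>

lemma PR_rec:
  assumes b: "PR b" and g: "PR (\<lambda>e. g (e 0) (e 1) (\<lambda>i. e (i + 2)))" and a: "PR a"
  shows "PR (\<lambda>e. rec_nat (b e) (\<lambda>k r. g k r e) (a e))"
proof -
  let ?G = "\<lambda>e. g (e 0) (e 1) (\<lambda>i. e (i + 2))"
  obtain nb where nb: "\<And>m. nb \<le> m \<Longrightarrow> \<exists>h. primrec_fun m h \<and> (\<forall>e. b e = h (map e [0..<m]))"
    using PR_arity[OF b] by blast
  obtain ng where ng: "\<And>m. ng \<le> m \<Longrightarrow> \<exists>h. primrec_fun m h \<and> (\<forall>e. ?G e = h (map e [0..<m]))"
    using PR_arity[OF g] by blast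
  define n where "n = nb + ng"
  obtain b' where b': "primrec_fun n b'" "\<And>e. b e = b' (map e [0..<n])"
    using nb[of n] by (auto simp: n_def)
  obtain g' where g': "primrec_fun (n + 2) g'" "\<And>e. ?G e = g' (map e [0..<n + 2])"
    using ng[of "n + 2"] by (auto simp: n_def)
  have g'_eq: "g k r e = g' (k # r # map e [0..<n])" for k r e
  proof -
    have "[0..<n + 2] = 0 # 1 # map (\<lambda>i. i + 2) [0..<n]"
      using map_add_upt[of 2 n] by (simp add: upt_conv_Cons numeral_2_eq_2 del: upt_Suc)
    moreover define e' where "e' = (\<lambda>i. case i of 0 \<Rightarrow> k | Suc j \<Rightarrow> (case j of 0 \<Rightarrow> r | Suc i \<Rightarrow> e i))"
    ultimately have "map e' [0..<n + 2] = k # r # map e [0..<n]"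
      by (simp add: o_def)
    moreover have "?G e' = g k r e" by (simp add: e'_def)
    ultimately show ?thesis using g'(2)[of e'] by simp
  qed
  let ?H = "\<lambda>xs. rec_nat (b' (tl xs)) (\<lambda>k r. g' (k # r # tl xs)) (hd xs)"
  have "primrec_fun (n + 1) ?H" using b'(1) g'(1) by (rule primrec_fun.prec)
  then have "PR (\<lambda>e. ?H (map e [0..<n + 1]))" unfolding PR_def by blast
  moreover have "PR (case i of 0 \<Rightarrow> a | Suc j \<Rightarrow> (\<lambda>e. e j))" for i
    using a PR_proj by (cases i) auto
  ultimately have "PR (\<lambda>e. ?H (map (\<lambda>i. (case i of 0 \<Rightarrow> a | Suc j \<Rightarrow> (\<lambda>e. e j)) e) [0..<n + 1]))"
    by (rule PR_subst)
  moreover have "map (\<lambda>i. (case i of 0 \<Rightarrow> a | Suc j \<Rightarrow> (\<lambda>e. e j)) e) [0..<n + 1]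
      = a e # map e [0..<n]" for e
  proof -
    have "[0..<n + 1] = 0 # map Suc [0..<n]"
      by (simp only: map_Suc_upt Suc_eq_plus1 [symmetric]) (simp add: upt_conv_Cons del: upt_Suc)
    then show ?thesis by (simp only: list.map map_map o_def nat.case)
  qed
  ultimately show ?thesis
    by (simp only: list.sel g'_eq b'(2))
qed

lemma PR_const: "PR (\<lambda>e. c)"
  by (induction c) (auto intro: PR_zero PR_Suc)

lemma PR_add: "PR a \<Longrightarrow> PR b \<Longrightarrow> PR (\<lambda>e. a e + b e)"
proof -
  have *: "x + y = rec_nat x (\<lambda>_ r. Suc r) y" for x y :: nat by (induction y) auto
  show "PR a \<Longrightarrow> PR b \<Longrightarrow> PR (\<lambda>e. a e + b e)"
    unfolding * by (intro PR_rec PR_Suc PR_proj)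
qed

lemma PR_mult: "PR a \<Longrightarrow> PR b \<Longrightarrow> PR (\<lambda>e. a e * b e)"
proof -
  have *: "x * y = rec_nat 0 (\<lambda>_ r. r + x) y" for x y :: nat by (induction y) auto
  assume "PR a" "PR b"
  moreover have "PR (\<lambda>e. e 0 * e 1)"
    unfolding * by (intro PR_rec PR_add PR_const PR_proj)
  ultimately show "PR (\<lambda>e. a e * b e)" using PR_subst2[of "(*)" a b] by blast
qed

lemma PR_pred: "PR a \<Longrightarrow> PR (\<lambda>e. a e - 1)"
proof -
  have *: "x - 1 = rec_nat 0 (\<lambda>k _. k) x" for x :: nat by (cases x) auto
  show "PR a \<Longrightarrow> PR (\<lambda>e. a e - 1)"
    unfolding * by (intro PR_rec PR_const PR_proj)
qed

lemma PR_diff: "PR a \<Longrightarrow> PR b \<Longrightarrow> PR (\<lambda>e. a e - b e)"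
proof -
  have "x - y = rec_nat x (\<lambda>_ r. r - 1) y" for x y :: nat by (induction y) auto
  then have *: "(\<lambda>e. a e - b e) = (\<lambda>e. rec_nat (a e) (\<lambda>_ r. r - 1) (b e))" by blast
  show "PR a \<Longrightarrow> PR b \<Longrightarrow> PR (\<lambda>e. a e - b e)"
    unfolding * by (intro PR_rec PR_pred PR_proj)
qed

lemma PR_if:
  assumes "PRP P" "PR a" "PR b"
  shows "PR (\<lambda>e. if P e then a e else b e)"
proof -
  have *: "(if p then x else y) = rec_nat y (\<lambda>_ _. x) (of_bool p)" for p and x y :: nat
    by simp
  have "PR (\<lambda>e. (\<lambda>p x y. rec_nat y (\<lambda>_ _. x) p) (e 0) (e 1) (e 2))"
    by (intro PR_rec PR_proj)
  from PR_subst3[OF this assms(1)[unfolded PRP_def] assms(2,3)] show ?thesis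
    unfolding * by simp
qed

lemma PR_of_bool: "PRP P \<Longrightarrow> PR (\<lambda>e. of_bool (P e))"
  by (simp add: PRP_def)

lemma PRP_zero:
  assumes "PR a"
  shows "PRP (\<lambda>e. a e = 0)"
proof -
  have *: "of_bool (x = 0) = 1 - x" for x :: nat by (cases x) auto
  show ?thesis unfolding PRP_def * using assms by (intro PR_diff PR_const)
qed

lemma PRP_not: "PRP P \<Longrightarrow> PRP (\<lambda>e. \<not> P e)"
  using PRP_zero[of "\<lambda>e. of_bool (P e)"] by (simp add: PRP_def)

lemma PRP_le: "PR a \<Longrightarrow> PR b \<Longrightarrow> PRP (\<lambda>e. a e \<le> b e)"
  using PRP_zero[of "\<lambda>e. a e - b e"] PR_diff by simp

lemma PRP_less: "PR a \<Longrightarrow> PR b \<Longrightarrow> PRP (\<lambda>e. a e < b e)"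
  using PRP_le[of "\<lambda>e. Suc (a e)" b] PR_Suc by (simp add: Suc_le_eq)

lemma PRP_conj: "PRP P \<Longrightarrow> PRP Q \<Longrightarrow> PRP (\<lambda>e. P e \<and> Q e)"
  using PR_mult[of "\<lambda>e. of_bool (P e)" "\<lambda>e. of_bool (Q e)"]
  by (simp add: PRP_def of_bool_conj)

lemma PRP_disj: "PRP P \<Longrightarrow> PRP Q \<Longrightarrow> PRP (\<lambda>e. P e \<or> Q e)"
  using PRP_not[OF PRP_conj[OF PRP_not PRP_not], of P Q] by simp

lemma PRP_eq: "PR a \<Longrightarrow> PR b \<Longrightarrow> PRP (\<lambda>e. a e = b e)"
  using PRP_conj[OF PRP_le PRP_le, of a b b a] by (simp add: eq_iff)

lemma PR_min: "PR a \<Longrightarrow> PR b \<Longrightarrow> PR (\<lambda>e. min (a e) (b e))"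
  unfolding min_def by (intro PR_if PRP_le)

lemma PR_max: "PR a \<Longrightarrow> PR b \<Longrightarrow> PR (\<lambda>e. max (a e) (b e))"
  unfolding max_def by (intro PR_if PRP_le)

text \<open>A bounded sum binds one variable, while the recursion that computes it binds two. The index and the
remaining variables are therefore moved past the accumulator at position \<open>1\<close>.\<close>

lemma PR_skip:
  assumes "PR (\<lambda>e. f (e 0) (\<lambda>i. e (Suc i)))"
  shows "PR (\<lambda>e. f (e 0) (\<lambda>i. e (i + 2)))"
proof -
  have "PR (\<lambda>e. e (case i of 0 \<Rightarrow> 0 | Suc j \<Rightarrow> j + 2))" for i
    by (rule PR_proj)
  from PR_subst[of _ "\<lambda>i e. e (case i of 0 \<Rightarrow> 0 | Suc j \<Rightarrow> j + 2)", OF assms this]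
  show ?thesis by simp
qed

lemma PR_sum:
  assumes f: "PR (\<lambda>e. f (e 0) (\<lambda>i. e (Suc i)))" and a: "PR a"
  shows "PR (\<lambda>e. \<Sum>i<a e. f i e)"
proof -
  have *: "(\<Sum>i<m. f i e) = rec_nat 0 (\<lambda>k r. r + f k e) m" for m e
    by (induction m) auto
  show ?thesis
    unfolding * using PR_skip[OF f] a by (intro PR_rec PR_add PR_const PR_proj)
qed

lemma PRP_ball:
  assumes "PRP (\<lambda>e. P (e 0) (\<lambda>i. e (Suc i)))" "PR a"
  shows "PRP (\<lambda>e. \<forall>i<a e. P i e)"
proof -
  have "PRP (\<lambda>e. (\<Sum>i<a e. of_bool (\<not> P i e)) = (0::nat))"
    using assms by (intro PRP_zero PR_sum PR_of_bool PRP_not)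
  moreover have "(\<Sum>i<m. of_bool (\<not> P i e)) = (0::nat) \<longleftrightarrow> (\<forall>i<m. P i e)" for m e
    by (simp only: sum_eq_0_iff finite_lessThan) auto
  ultimately show ?thesis by simp
qed

lemma PRP_bex:
  assumes "PRP (\<lambda>e. P (e 0) (\<lambda>i. e (Suc i)))" "PR a"
  shows "PRP (\<lambda>e. \<exists>i<a e. P i e)"
  using PRP_not[OF PRP_ball[OF PRP_not, OF assms]] by simp

text \<open>The least solution is the number of arguments up to which no solution has appeared. This makes
minimisation below a bound a special case of bounded summation.\<close>

lemma Least_eq_sum:
  fixes P :: "nat \<Rightarrow> bool"
  assumes "P b"
  shows "(LEAST y. P y) = (\<Sum>i<b. of_bool (\<forall>j<Suc i. \<not> P j))"
proof -
  have "i < (LEAST y. P y) \<longleftrightarrow> i < b \<and> (\<forall>j<Suc i. \<not> P j)" for i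
  proof
    assume less: "i < (LEAST y. P y)"
    moreover have "(LEAST y. P y) \<le> b" using assms by (rule Least_le)
    moreover have "\<not> P j" if "j < Suc i" for j
      using that less by (intro not_less_Least) simp
    ultimately show "i < b \<and> (\<forall>j<Suc i. \<not> P j)" by simp
  next
    assume "i < b \<and> (\<forall>j<Suc i. \<not> P j)"
    moreover have "P (LEAST y. P y)" using assms by (rule LeastI)
    ultimately have "\<not> (LEAST y. P y) < Suc i" by blast
    then show "i < (LEAST y. P y)" by simp
  qed
  then have "{i. i < b \<and> (\<forall>j<Suc i. \<not> P j)} = {..<LEAST y. P y}" by auto
  moreover have "{..<b} \<inter> {i. \<forall>j<Suc i. \<not> P j} = {i. i < b \<and> (\<forall>j<Suc i. \<not> P j)}"
    by auto
  ultimately show ?thesis by (simp add: sum.If_cases of_bool_def)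
qed

lemma PR_Least:
  assumes P: "PRP (\<lambda>e. P (e 0) (\<lambda>i. e (Suc i)))" and b: "PR b" and bound: "\<And>e. P (b e) e"
  shows "PR (\<lambda>e. LEAST y. P y e)"
proof -
  have eq: "(LEAST y. P y e) = (\<Sum>i<b e. of_bool (\<forall>j<Suc i. \<not> P j e))" for e
    using bound by (rule Least_eq_sum)
  have "PRP (\<lambda>e. P (e 0) (\<lambda>i. e (Suc (Suc i))))"
    using PR_skip[OF P[unfolded PRP_def]] by (simp add: PRP_def)
  then show ?thesis
    unfolding eq using b by (intro PR_sum PR_of_bool PRP_ball PRP_not PR_Suc PR_proj)
qed

lemmas PR_intros = PR_proj PR_const PR_Suc PR_add PR_mult PR_diff PR_min PR_max PR_if PR_of_bool
  PR_sum PRP_not PRP_le PRP_less PRP_conj PRP_disj PRP_eq PRP_ball PRP_bex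

lemma PRP_even: "PR a \<Longrightarrow> PRP (\<lambda>e. even (a e))"
proof -
  have *: "of_bool (even x) = (rec_nat 1 (\<lambda>_ r. 1 - r) x :: nat)" for x :: nat
    by (induction x) auto
  show "PR a \<Longrightarrow> PRP (\<lambda>e. even (a e))"
    unfolding PRP_def * by (intro PR_rec PR_intros)
qed

lemma PR_half: "PR a \<Longrightarrow> PR (\<lambda>e. a e div 2)"
proof -
  have *: "x div 2 = (\<Sum>i<x. of_bool (i + i + 1 < x))" for x :: nat
  proof -
    have "{..<x} \<inter> {i. i + i + 1 < x} = {..<x div 2}" by auto
    then show ?thesis by (simp add: sum.If_cases of_bool_def)
  qed
  have "PR (\<lambda>e. e 0 div 2)" unfolding * by (intro PR_intros)
  then show "PR a \<Longrightarrow> PR (\<lambda>e. a e div 2)" by (rule PR_subst1)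
qed

lemma primrec_unary_iff_PR: "primrec_unary f \<longleftrightarrow> PR (\<lambda>e. f (e 0))"
proof
  assume "primrec_unary f"
  then obtain g where "primrec_fun 1 g" "\<forall>x. f x = g [x]" unfolding primrec_unary_def by blast
  then show "PR (\<lambda>e. f (e 0))" unfolding PR_def by (intro exI[of _ 1] exI[of _ g]) auto
next
  assume "PR (\<lambda>e. f (e 0))"
  then obtain n g where g: "primrec_fun n g" "\<And>e. f (e 0) = g (map e [0..<n])"
    unfolding PR_def by blast
  have "primrec_fun 1 (\<lambda>xs. g (map (\<lambda>p. p xs) (replicate n (\<lambda>xs. xs ! 0))))"
    using g(1) by (intro primrec_fun.comp) (auto intro: primrec_fun.proj)
  moreover have "f x = g (map (\<lambda>p. p [x]) (replicate n (\<lambda>xs. xs ! 0)))" for x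
    using g(2)[of "\<lambda>_. x"] by (simp add: map_replicate_const)
  ultimately show "primrec_unary f" unfolding primrec_unary_def by (intro exI conjI allI)
qed

lemma PR_unary: "primrec_unary f \<Longrightarrow> PR a \<Longrightarrow> PR (\<lambda>e. f (a e))"
  unfolding primrec_unary_iff_PR by (rule PR_subst1)

lemma primrec_set_iff_PRP: "primrec_set X \<longleftrightarrow> PRP (\<lambda>e. e 0 \<in> X)"
  unfolding primrec_set_def primrec_unary_iff_PR PRP_def of_bool_def ..

lemma PRP_set: "primrec_set X \<Longrightarrow> PR a \<Longrightarrow> PRP (\<lambda>e. a e \<in> X)"
  unfolding primrec_set_iff_PRP PRP_def by (rule PR_subst1)

lemma primrec_rel_iff_PRP: "primrec_rel R \<longleftrightarrow> PRP (\<lambda>e. (e 0, e 1) \<in> R)"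
proof
  assume "primrec_rel R"
  then obtain g where "primrec_fun 2 g" "\<forall>x y. (if (x, y) \<in> R then 1 else 0) = g [x, y]"
    unfolding primrec_rel_def by blast
  then show "PRP (\<lambda>e. (e 0, e 1) \<in> R)" unfolding PRP_def PR_def of_bool_def
    by (intro exI[of _ 2] exI[of _ g]) (auto simp: upt_rec)
next
  assume "PRP (\<lambda>e. (e 0, e 1) \<in> R)"
  then obtain n g where g: "primrec_fun n g"
      "\<And>e. (if (e 0, e 1) \<in> R then 1 else 0) = g (map e [0..<n])"
    unfolding PRP_def PR_def of_bool_def by blast
  define ps where "ps = map (\<lambda>i (xs :: nat list). xs ! (if i = 0 then 0 else 1)) [0..<n]"
  have "primrec_fun 2 (\<lambda>xs. g (map (\<lambda>p. p xs) ps))"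
    using g(1) by (intro primrec_fun.comp) (auto simp: ps_def intro: primrec_fun.proj)
  moreover have "(if (x, y) \<in> R then 1 else 0) = g (map (\<lambda>p. p [x, y]) ps)" for x y
    using g(2)[of "\<lambda>i. [x, y] ! (if i = 0 then 0 else 1)"] by (simp add: ps_def o_def)
  ultimately show "primrec_rel R" unfolding primrec_rel_def by (intro exI conjI allI)
qed

lemma PRP_rel: "primrec_rel R \<Longrightarrow> PR a \<Longrightarrow> PR b \<Longrightarrow> PRP (\<lambda>e. (a e, b e) \<in> R)"
  unfolding primrec_rel_iff_PRP PRP_def by (rule PR_subst2)

section \<open>Primitive recursive coding\<close>

lemma PR_triangle: "PR a \<Longrightarrow> PR (\<lambda>e. triangle (a e))"
proof -
  have *: "triangle x = (\<Sum>i<x. Suc i)" for x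
    by (induction x) auto
  show "PR a \<Longrightarrow> PR (\<lambda>e. triangle (a e))"
    unfolding * by (intro PR_intros)
qed

lemma PR_pair: "PR a \<Longrightarrow> PR b \<Longrightarrow> PR (\<lambda>e. prod_encode (a e, b e))"
  unfolding prod_encode_def by (simp add: PR_add PR_triangle)

text \<open>A function with a primitive recursive graph that stays below its argument: the bounded sum over
all candidates has the value as its only nonzero term.\<close>

lemma PR_bounded_witness:
  assumes Q: "PRP (\<lambda>e. Q (e 0) (e 1))" and f: "\<And>n. f n \<le> n" "\<And>n x. Q x n \<longleftrightarrow> x = f n"
    and a: "PR a"
  shows "PR (\<lambda>e. f (a e))"
proof (rule PR_subst1[OF _ a])
  have "f n = (\<Sum>x<Suc n. if Q x n then x else 0)" for n
  proof -
    have "(\<Sum>x<Suc n. if Q x n then x else 0) = (\<Sum>x<Suc n. if x = f n then f n else 0)"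
      using f(2) by (intro sum.cong) auto
    then show ?thesis using f(1)[of n] by (simp add: le_imp_less_Suc del: sum.lessThan_Suc)
  qed
  moreover have "PR (\<lambda>e. \<Sum>x<Suc (e 0). if Q x (e 0) then x else 0)"
    using Q by (intro PR_intros) simp
  ultimately show "PR (\<lambda>e. f (e 0))" by simp
qed

lemma PR_fst:
  assumes "PR a"
  shows "PR (\<lambda>e. fst (prod_decode (a e)))"
proof (rule PR_bounded_witness[OF _ _ _ assms])
  show "PRP (\<lambda>e. \<exists>y<Suc (e 1). prod_encode (e 0, y) = e 1)"
    by (intro PR_intros PR_pair)
  fix n x
  show "fst (prod_decode n) \<le> n"
    by (metis le_prod_encode_1 prod.collapse prod_decode_inverse)
  show "(\<exists>y<Suc n. prod_encode (x, y) = n) \<longleftrightarrow> x = fst (prod_decode n)"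
    by (metis fst_conv le_imp_less_Suc le_prod_encode_2 prod.collapse prod_decode_inverse
        prod_encode_inverse)
qed

lemma PR_snd:
  assumes "PR a"
  shows "PR (\<lambda>e. snd (prod_decode (a e)))"
proof (rule PR_bounded_witness[OF _ _ _ assms])
  show "PRP (\<lambda>e. \<exists>x<Suc (e 1). prod_encode (x, e 0) = e 1)"
    by (intro PR_intros PR_pair)
  fix n y
  show "snd (prod_decode n) \<le> n"
    by (metis le_prod_encode_2 prod.collapse prod_decode_inverse)
  show "(\<exists>x<Suc n. prod_encode (x, y) = n) \<longleftrightarrow> y = snd (prod_decode n)"
    by (metis snd_conv le_imp_less_Suc le_prod_encode_1 prod.collapse prod_decode_inverse
        prod_encode_inverse)
qed

section \<open>A hierarchy that dominates the primitive recursive functions\<close>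

text \<open>A variant of the fast-growing hierarchy. At least \<open>x + 1\<close> iterations absorb a primitive recursion
of length \<open>x\<close>, and at least two absorb a composition; \<open>x + 2\<close> serves both purposes also at
\<open>x = 0\<close>.\<close>

fun fgh :: "nat \<Rightarrow> nat \<Rightarrow> nat" where
  "fgh 0 x = Suc x"
| "fgh (Suc k) x = (fgh k ^^ (x + 2)) x"

lemma primrec_unary_fgh: "primrec_unary (fgh k)"
proof (induction k)
  case 0
  show ?case unfolding primrec_unary_iff_PR by (simp add: PR_Suc PR_proj)
next
  case (Suc k)
  have "(fgh k ^^ m) x = rec_nat x (\<lambda>_ r. fgh k r) m" for m x
    by (induction m) auto
  then have *: "fgh (Suc k) x = rec_nat x (\<lambda>_ r. fgh k r) (x + 2)" for x
    by simp
  show ?case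
    unfolding primrec_unary_iff_PR * by (intro PR_rec PR_unary[OF Suc] PR_intros)
qed

lemma funpow_less:
  fixes f :: "nat \<Rightarrow> nat"
  assumes "\<And>x. x < f x"
  shows "m \<le> n \<Longrightarrow> (f ^^ m) x \<le> (f ^^ n) x"
proof (induction rule: dec_induct)
  case (step n)
  then show ?case using assms[of "(f ^^ n) x"] by simp
qed simp

lemma fgh_greater: "x < fgh k x"
proof (induction k arbitrary: x)
  case (Suc k)
  have "x < fgh k x" by (rule Suc)
  also have "fgh k x = (fgh k ^^ 1) x" by simp
  also have "\<dots> \<le> (fgh k ^^ (x + 2)) x" by (rule funpow_less[OF Suc]) simp
  finally show ?case by simp
qed simp

lemma fgh_funpow_mono: "m \<le> n \<Longrightarrow> (fgh k ^^ m) x \<le> (fgh k ^^ n) x"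
  by (rule funpow_less[OF fgh_greater])

lemma fgh_twice: "fgh k (fgh k x) \<le> fgh (Suc k) x"
  using fgh_funpow_mono[of 2 "x + 2" k x] by (simp add: numeral_2_eq_2)

lemma fgh_level_mono: "k \<le> l \<Longrightarrow> fgh k x \<le> fgh l x"
proof (induction rule: dec_induct)
  case (step l)
  then show ?case using fgh_twice[of l x] fgh_greater[of "fgh l x" l] by simp
qed simp

text \<open>Bounding by a common upper bound \<open>b\<close> of the arguments, instead of their sum, makes composition cost
one level: the inner functions are at most \<open>fgh K b\<close>, the outer one adds a second application of
\<open>fgh K\<close>. In a primitive recursion, \<open>m\<close> steps cost \<open>m + 1\<close> applications of \<open>fgh K\<close>, and
\<open>m \<le> b\<close>, so one more level suffices again.\<close>

lemma fgh_dominates_primrec_fun: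
  assumes "primrec_fun n f"
  shows "\<exists>k. \<forall>xs b. length xs = n \<longrightarrow> (\<forall>x\<in>set xs. x \<le> b) \<longrightarrow> f xs \<le> fgh k b"
  using assms
proof (induction rule: primrec_fun.induct)
  case (succ)
  show ?case by (rule exI[of _ 0]) auto
next
  case (proj i n)
  then show ?case by (intro exI[of _ 0]) (auto intro: le_SucI)
next
  case (comp gs f n)
  obtain kf where kf: "\<And>xs b. length xs = length gs \<Longrightarrow> \<forall>x\<in>set xs. x \<le> b \<Longrightarrow> f xs \<le> fgh kf b"
    using comp.IH by blast
  have "\<exists>kg. \<forall>g\<in>set gs. \<forall>xs b. length xs = n \<longrightarrow> (\<forall>x\<in>set xs. x \<le> b) \<longrightarrow> g xs \<le> fgh (kg g) b"
    using comp by (intro bchoice) blast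
  then obtain kg where kg: "\<And>g xs b. g \<in> set gs \<Longrightarrow> length xs = n \<Longrightarrow> \<forall>x\<in>set xs. x \<le> b \<Longrightarrow>
      g xs \<le> fgh (kg g) b"
    by blast
  define K where "K = kf + (\<Sum>g\<in>set gs. kg g)"
  have K: "kf \<le> K" "\<And>g. g \<in> set gs \<Longrightarrow> kg g \<le> K"
    unfolding K_def by (auto intro: trans_le_add2 member_le_sum)
  have "f (map (\<lambda>g. g xs) gs) \<le> fgh (Suc K) b"
    if "length xs = n" "\<forall>x\<in>set xs. x \<le> b" for xs b
  proof -
    have "g xs \<le> fgh K b" if "g \<in> set gs" for g
      using kg[OF that \<open>length xs = n\<close> \<open>\<forall>x\<in>set xs. x \<le> b\<close>] fgh_level_mono[OF K(2)[OF that], of b]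
      by simp
    then have "f (map (\<lambda>g. g xs) gs) \<le> fgh kf (fgh K b)" by (intro kf) auto
    also have "\<dots> \<le> fgh K (fgh K b)" using K(1) by (rule fgh_level_mono)
    also have "\<dots> \<le> fgh (Suc K) b" by (rule fgh_twice)
    finally show ?thesis .
  qed
  then show ?case by blast
next
  case (prec n f g)
  obtain kf where kf: "\<And>xs b. length xs = n \<Longrightarrow> \<forall>x\<in>set xs. x \<le> b \<Longrightarrow> f xs \<le> fgh kf b"
    using prec.IH(1) by blast
  obtain kg where kg: "\<And>xs b. length xs = n + 2 \<Longrightarrow> \<forall>x\<in>set xs. x \<le> b \<Longrightarrow> g xs \<le> fgh kg b"
    using prec.IH(2) by blast
  define K where "K = max kf kg"
  have "rec_nat (f (tl xs)) (\<lambda>k r. g (k # r # tl xs)) (hd xs) \<le> fgh (Suc K) b"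
    if len: "length xs = n + 1" and "\<forall>x\<in>set xs. x \<le> b" for xs b
  proof -
    obtain y ys where xs: "xs = y # ys" using len by (cases xs) auto
    then have ys: "length ys = n" "\<forall>x\<in>set ys. x \<le> b" "y \<le> b" using that by auto
    \<comment> \<open>The iterate also bounds the counter and the parameters that are passed to the step function.\<close>
    have b_le: "b \<le> (fgh K ^^ m) b" for m using fgh_funpow_mono[of 0 m K b] by simp
    have "rec_nat (f ys) (\<lambda>k r. g (k # r # ys)) m \<le> (fgh K ^^ Suc m) b" if "m \<le> b" for m
      using that
    proof (induction m)
      case 0
      have "f ys \<le> fgh kf b" using ys by (intro kf)
      also have "\<dots> \<le> fgh K b" by (rule fgh_level_mono) (simp add: K_def)
      finally show ?case by simp
    next
      case (Suc m)
      let ?r = "rec_nat (f ys) (\<lambda>k r. g (k # r # ys)) m"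
      have "?r \<le> (fgh K ^^ Suc m) b" "m \<le> (fgh K ^^ Suc m) b"
        using Suc b_le[of "Suc m"] by auto
      then have "g (m # ?r # ys) \<le> fgh kg ((fgh K ^^ Suc m) b)"
        using ys b_le[of "Suc m"] by (intro kg) (auto intro: order_trans)
      also have "\<dots> \<le> fgh K ((fgh K ^^ Suc m) b)" by (rule fgh_level_mono) (simp add: K_def)
      finally show ?case by simp
    qed
    from this[OF ys(3)] have "rec_nat (f ys) (\<lambda>k r. g (k # r # ys)) y \<le> (fgh K ^^ Suc y) b" .
    also have "\<dots> \<le> (fgh K ^^ (b + 2)) b" using ys(3) by (intro fgh_funpow_mono) simp
    finally show ?thesis by (simp add: xs)
  qed
  then show ?case by blast
qed simp

lemma fgh_dominates:
  assumes "primrec_unary h"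
  obtains k where "\<And>x. h x \<le> fgh k x"
proof -
  obtain g where g: "primrec_fun 1 g" "\<And>x. h x = g [x]"
    using assms unfolding primrec_unary_def by blast
  from fgh_dominates_primrec_fun[OF g(1)] obtain k where
    k: "\<forall>xs b. length xs = 1 \<longrightarrow> (\<forall>x\<in>set xs. x \<le> b) \<longrightarrow> g xs \<le> fgh k b" ..
  have "h x \<le> fgh k x" for x unfolding g(2) by (rule k[rule_format]) simp_all
  then show thesis by (rule that)
qed

text \<open>The function \<open>(n, x) \<mapsto> fgh n x\<close> is not primitive recursive, but a single step of its evaluation
is. The list is a stack of levels that have yet to be applied, in order from its head, to the value
in the second component.\<close>

fun fgh_step :: "nat list \<times> nat \<Rightarrow> nat list \<times> nat" where
  "fgh_step ([], x) = ([], x)"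
| "fgh_step (0 # l, x) = (l, Suc x)"
| "fgh_step (Suc k # l, x) = (replicate (x + 2) k @ l, x)"

lemma fgh_step_reaches: "\<exists>t. (fgh_step ^^ t) (k # l, x) = (l, fgh k x)"
proof (induction k arbitrary: l x)
  case 0
  show ?case by (rule exI[of _ 1]) simp
next
  case (Suc k)
  have iter: "\<exists>t. (fgh_step ^^ t) (replicate m k @ l, y) = (l, (fgh k ^^ m) y)" for m y
  proof (induction m arbitrary: y)
    case 0
    show ?case by (rule exI[of _ 0]) simp
  next
    case (Suc m)
    obtain t where "(fgh_step ^^ t) (k # replicate m k @ l, y) = (replicate m k @ l, fgh k y)"
      using \<open>\<And>l x. \<exists>t. (fgh_step ^^ t) (k # l, x) = (l, fgh k x)\<close> by blast
    moreover obtain t' where "(fgh_step ^^ t') (replicate m k @ l, fgh k y) = (l, (fgh k ^^ m) (fgh k y))"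
      using Suc by blast
    ultimately have "(fgh_step ^^ (t' + t)) (replicate (Suc m) k @ l, y) = (l, (fgh k ^^ Suc m) y)"
      by (simp add: funpow_add funpow_swap1)
    then show ?case by blast
  qed
  obtain t where "(fgh_step ^^ t) (replicate (x + 2) k @ l, x) = (l, fgh (Suc k) x)"
    using iter[of "x + 2" x] by auto
  then have "(fgh_step ^^ Suc t) (Suc k # l, x) = (l, fgh (Suc k) x)"
    by (simp add: funpow_swap1)
  then show ?case by blast
qed

lemma fgh_step_halted: "(fgh_step ^^ t) ([], y) = ([], y)"
  by (induction t) auto

text \<open>The graph of \<open>fgh\<close>, restricted to computations of at most \<open>t\<close> steps. Unlike the value itself,
this is primitive recursive in all four arguments.\<close>

definition fgh_halts :: "nat \<Rightarrow> nat \<Rightarrow> nat \<Rightarrow> nat \<Rightarrow> bool" where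
  "fgh_halts k x y t \<longleftrightarrow> (fgh_step ^^ t) ([k], x) = ([], y)"

lemma fgh_halts_later: "fgh_halts k x y t \<Longrightarrow> t \<le> u \<Longrightarrow> fgh_halts k x y u"
  using funpow_add[of "u - t" t fgh_step] by (simp add: fgh_halts_def fgh_step_halted)

lemma fgh_halts_value: "fgh_halts k x y t \<Longrightarrow> y = fgh k x"
proof -
  obtain u where u: "fgh_halts k x (fgh k x) u"
    unfolding fgh_halts_def using fgh_step_reaches by blast
  assume "fgh_halts k x y t"
  from fgh_halts_later[OF this, of "max t u"] fgh_halts_later[OF u, of "max t u"]
  show "y = fgh k x" by (simp add: fgh_halts_def)
qed

definition encode_config :: "nat list \<times> nat \<Rightarrow> nat" where
  "encode_config c = prod_encode (list_encode (fst c), snd c)"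

lemma inj_encode_config: "encode_config c = encode_config d \<longleftrightarrow> c = d"
  by (metis encode_config_def list_encode_eq prod.collapse prod.inject prod_encode_eq)

text \<open>One machine step on codes. Here \<open>l\<close> is the code of the stack, which is \<open>0\<close> for the empty stack and
one more than the code of the pair of head \<open>k\<close> and tail \<open>m\<close> otherwise; the recursion pushes
\<open>x + 2\<close> copies of \<open>k - 1\<close>.\<close>

definition encoded_step :: "nat \<Rightarrow> nat" where
  "encoded_step c = (let l = fst (prod_decode c); x = snd (prod_decode c);
      k = fst (prod_decode (l - 1)); m = snd (prod_decode (l - 1)) in
    if l = 0 then c
    else if k = 0 then prod_encode (m, Suc x)
    else prod_encode (rec_nat m (\<lambda>_ r. Suc (prod_encode (k - 1, r))) (x + 2), x))"

lemma encoded_step_correct: "encoded_step (encode_config c) = encode_config (fgh_step c)"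
proof -
  have push: "rec_nat (list_encode l) (\<lambda>_ r. Suc (prod_encode (k, r))) m
      = list_encode (replicate m k @ l)" for l k m
    by (induction m) auto
  show ?thesis
    by (cases c rule: fgh_step.cases)
      (simp_all add: encoded_step_def encode_config_def Let_def push del: old.nat.simps(7))
qed

lemma PRP_fgh_halts:
  assumes "PR k" "PR x" "PR y" "PR t"
  shows "PRP (\<lambda>e. fgh_halts (k e) (x e) (y e) (t e))"
proof -
  have run: "encode_config ((fgh_step ^^ t) c) = rec_nat (encode_config c) (\<lambda>_ r. encoded_step r) t" for c t
    by (induction t) (auto simp flip: encoded_step_correct)
  have halts: "fgh_halts k x y t \<longleftrightarrow> rec_nat (prod_encode (Suc (prod_encode (k, 0)), x))
      (\<lambda>_ r. encoded_step r) t = prod_encode (0, y)" for k x y t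
    using run[of t "([k], x)"] inj_encode_config[of "(fgh_step ^^ t) ([k], x)" "([], y)"]
    by (simp add: fgh_halts_def encode_config_def)
  have "PR (\<lambda>e. encoded_step (e 0))"
    unfolding encoded_step_def Let_def
    by (intro PR_rec PR_intros PR_pair PR_fst PR_snd)
  then have step: "PR a \<Longrightarrow> PR (\<lambda>e. encoded_step (a e))" for a by (rule PR_subst1)
  show ?thesis
    unfolding halts using assms by (intro step PR_rec PR_intros PR_pair)
qed

section \<open>Counting classes\<close>

definition num_classes :: "nat rel \<Rightarrow> nat \<Rightarrow> nat" where
  "num_classes R s = card ((\<lambda>i. R `` {i}) ` {..s})"

definition class_counter :: "(nat \<Rightarrow> nat) \<Rightarrow> bool" where
  "class_counter c \<longleftrightarrow> primrec_unary c \<and> c 0 = 1 \<and>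
    (\<forall>s. c s \<le> c (Suc s) \<and> c (Suc s) \<le> Suc (c s)) \<and> (\<forall>n. \<exists>s. n \<le> c s)"

definition counter_le :: "(nat \<Rightarrow> nat) \<Rightarrow> (nat \<Rightarrow> nat) \<Rightarrow> bool" where
  "counter_le c d \<longleftrightarrow> (\<exists>h. primrec_unary h \<and> (\<forall>s. c s \<le> d (h s)))"

lemma class_counter_step: "class_counter c \<Longrightarrow> c s \<le> c (Suc s) \<and> c (Suc s) \<le> Suc (c s)"
  by (simp add: class_counter_def)

lemma class_counter_mono: "class_counter c \<Longrightarrow> mono c"
  by (simp add: class_counter_def mono_iff_le_Suc)

text \<open>A counter cannot jump over a value, so it takes the value \<open>k\<close> when it first reaches it.\<close>

lemma class_counter_attains:
  assumes "class_counter c" "0 < k"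
  shows "c (LEAST s. k \<le> c s) = k"
proof -
  let ?s = "LEAST s. k \<le> c s"
  obtain s where "k \<le> c s" using assms(1) unfolding class_counter_def by blast
  then have ge: "k \<le> c ?s" by (rule LeastI)
  have "c ?s \<le> k"
  proof (cases ?s)
    case 0
    then show ?thesis using assms by (simp add: class_counter_def)
  next
    case (Suc s)
    then have "\<not> k \<le> c s" using not_less_Least[of s "\<lambda>s. k \<le> c s"] by simp
    moreover have "c (Suc s) \<le> Suc (c s)" using assms(1) by (simp add: class_counter_def)
    ultimately show ?thesis unfolding Suc by simp
  qed
  with ge show ?thesis by simp
qed

lemma num_classes_Suc:
  assumes "equiv UNIV R"
  shows "num_classes R (Suc s) = num_classes R s + of_bool (\<forall>j<Suc s. (j, Suc s) \<notin> R)"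
proof -
  have "R `` {Suc s} \<in> (\<lambda>i. R `` {i}) ` {..s} \<longleftrightarrow> \<not> (\<forall>j<Suc s. (j, Suc s) \<notin> R)"
    using eq_equiv_class_iff[OF assms] by (auto simp: less_Suc_eq_le)
  moreover have "(\<lambda>i. R `` {i}) ` {..Suc s} = insert (R `` {Suc s}) ((\<lambda>i. R `` {i}) ` {..s})"
    by (simp add: atMost_Suc)
  ultimately show ?thesis
    by (simp add: num_classes_def card_insert_if)
qed

lemma num_classes_eq_sum:
  assumes "equiv UNIV R"
  shows "num_classes R s = (\<Sum>i<Suc s. of_bool (\<forall>j<i. (j, i) \<notin> R))"
proof (induction s)
  case 0
  show ?case by (simp add: num_classes_def)
next
  case (Suc s)
  show ?case
    unfolding num_classes_Suc[OF assms] Suc by (rule sum.lessThan_Suc[symmetric])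
qed

lemma class_counter_num_classes:
  assumes "punctual R"
  shows "class_counter (num_classes R)"
  unfolding class_counter_def
proof (intro conjI allI)
  have R: "equiv UNIV R" "primrec_rel R" "infinite (UNIV // R)"
    using assms by (auto simp: punctual_def)
  show "primrec_unary (num_classes R)"
    unfolding primrec_unary_iff_PR num_classes_eq_sum[OF R(1)]
    by (intro PR_intros PRP_rel[OF R(2)])
  show "num_classes R 0 = 1" by (simp add: num_classes_def)
  fix n
  obtain B where B: "B \<subseteq> UNIV // R" "finite B" "card B = n"
    using R(3) by (meson infinite_arbitrarily_large)
  have "\<forall>b\<in>B. \<exists>i. b = R `` {i}" using B(1) by (auto elim!: quotientE)
  then obtain i where i: "\<And>b. b \<in> B \<Longrightarrow> b = R `` {i b}" by metis
  define s where "s = (\<Sum>b\<in>B. i b)"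
  have "i b \<le> s" if "b \<in> B" for b unfolding s_def using B(2) that by (intro member_le_sum) auto
  then have "B \<subseteq> (\<lambda>i. R `` {i}) ` {..s}" using i by blast
  then have "n \<le> num_classes R s"
    unfolding num_classes_def B(3)[symmetric] by (intro card_mono) auto
  then show "\<exists>s. n \<le> num_classes R s" ..
qed (use num_classes_Suc[of R] assms in \<open>simp_all add: punctual_def\<close>)

lemma num_classes_less:
  assumes "equiv UNIV R" "j < i" "\<forall>j<i. (j, i) \<notin> R"
  shows "num_classes R j < num_classes R i"
proof -
  obtain i' where i: "i = Suc i'" using assms(2) by (cases i) auto
  have "mono (num_classes R)"
    using num_classes_Suc[OF assms(1)] by (simp add: mono_iff_le_Suc)
  then have "num_classes R j \<le> num_classes R i'" using assms(2) i by (auto intro: monoD)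
  then show ?thesis using num_classes_Suc[OF assms(1), of i'] assms(3) i by simp
qed

lemma card_image_cong:
  assumes "\<And>i j. F i = F j \<longleftrightarrow> G i = G j"
  shows "card (F ` A) = card (G ` A)"
proof -
  define \<phi> where "\<phi> C = G (SOME i. F i = C)" for C
  have \<phi>: "\<phi> (F x) = G x" for x
    unfolding \<phi>_def using someI[of "\<lambda>i. F i = F x" x] assms by blast
  then have "card (\<phi> ` F ` A) = card (F ` A)"
    using assms by (intro card_image) (auto simp: inj_on_def)
  then show ?thesis using \<phi> by (simp add: image_image)
qed

text \<open>A reduction induces an injection on classes. With \<open>h s\<close> an upper bound of its values on
\<open>{0..s}\<close>, the classes of \<open>R\<close> that meet \<open>{0..s}\<close> are mapped to classes of \<open>S\<close> that meet
\<open>{0..h s}\<close>.\<close>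

lemma pr_le_imp_counter_le:
  assumes "equiv UNIV R" "equiv UNIV S" "R \<le>\<^sub>p\<^sub>r S"
  shows "counter_le (num_classes R) (num_classes S)"
proof -
  obtain f where f: "primrec_unary f" "\<And>x y. (x, y) \<in> R \<longleftrightarrow> (f x, f y) \<in> S"
    using assms(3) unfolding pr_le_def by blast
  define h where "h s = (\<Sum>i<Suc s. f i)" for s
  have "primrec_unary h"
    unfolding primrec_unary_iff_PR h_def by (intro PR_intros PR_unary[OF f(1)])
  moreover have "num_classes R s \<le> num_classes S (h s)" for s
  proof -
    have "f i \<le> h s" if "i \<le> s" for i
      unfolding h_def using that by (intro member_le_sum) auto
    then have "(\<lambda>i. S `` {f i}) ` {..s} \<subseteq> (\<lambda>i. S `` {i}) ` {..h s}" by auto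
    then have "card ((\<lambda>i. S `` {f i}) ` {..s}) \<le> num_classes S (h s)"
      unfolding num_classes_def by (intro card_mono) auto
    moreover have "R `` {i} = R `` {j} \<longleftrightarrow> S `` {f i} = S `` {f j}" for i j
      using eq_equiv_class_iff[OF assms(1)] eq_equiv_class_iff[OF assms(2)] f(2) by simp
    then have "num_classes R s = card ((\<lambda>i. S `` {f i}) ` {..s})"
      unfolding num_classes_def by (rule card_image_cong)
    ultimately show ?thesis by simp
  qed
  ultimately show ?thesis unfolding counter_le_def by blast
qed

text \<open>The reduction sends \<open>x\<close> to the least element of the \<open>k\<close>-th class of \<open>S\<close>, in order of appearance,
if \<open>x\<close> lies in the \<open>k\<close>-th class of \<open>R\<close>. The bound \<open>h\<close> keeps the search for it primitive
recursive.\<close>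

lemma counter_le_imp_pr_le:
  assumes R: "punctual R" and S: "punctual S"
    and le: "counter_le (num_classes R) (num_classes S)"
  shows "R \<le>\<^sub>p\<^sub>r S"
proof -
  have eR: "equiv UNIV R" and eS: "equiv UNIV S" and pR: "primrec_rel R"
    using R S by (auto simp: punctual_def)
  have cR: "class_counter (num_classes R)" and cS: "class_counter (num_classes S)"
    using R S class_counter_num_classes by auto
  obtain h where h: "primrec_unary h" "\<And>s. num_classes R s \<le> num_classes S (h s)"
    using le unfolding counter_le_def by blast
  define rep where "rep x = (LEAST j. (j, x) \<in> R)" for x
  define nth_class where "nth_class k = (LEAST y. k \<le> num_classes S y)" for k
  define f where "f x = nth_class (num_classes R (rep x))" for x
  have refl: "(x, x) \<in> R" for x using eR by (auto simp: equiv_def refl_on_def)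
  have rep: "(rep x, x) \<in> R" "rep x \<le> x" for x
    unfolding rep_def using LeastI[of "\<lambda>j. (j, x) \<in> R", OF refl] Least_le[of "\<lambda>j. (j, x) \<in> R", OF refl]
    by auto
  have rep_eq: "(x, y) \<in> R \<longleftrightarrow> rep x = rep y" for x y
  proof
    assume "(x, y) \<in> R"
    then have "(\<lambda>j. (j, x) \<in> R) = (\<lambda>j. (j, y) \<in> R)"
      using eR by (auto simp: fun_eq_iff equiv_def dest: symD transD)
    then show "rep x = rep y" by (simp add: rep_def)
  next
    assume "rep x = rep y"
    then show "(x, y) \<in> R" using rep(1)[of x] rep(1)[of y] eR
      by (auto simp: equiv_def dest: symD transD)
  qed
  have rep_first: "\<forall>j<rep x. (j, rep x) \<notin> R" for x
  proof (intro allI impI notI)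
    fix j
    assume "j < rep x" "(j, rep x) \<in> R"
    then have "(j, x) \<in> R" using rep(1)[of x] eR by (auto simp: equiv_def dest: transD)
    then show False using \<open>j < rep x\<close> not_less_Least unfolding rep_def by blast
  qed
  have pos: "0 < num_classes R x" for x
    using monoD[OF class_counter_mono[OF cR], of 0 x] cR by (simp add: class_counter_def)
  have num_f: "num_classes S (f x) = num_classes R (rep x)" for x
    unfolding f_def nth_class_def using pos by (intro class_counter_attains[OF cS])
  have f_first: "\<forall>j<f x. (j, f x) \<notin> S" for x
  proof (rule ccontr)
    assume not: "\<not> (\<forall>j<f x. (j, f x) \<notin> S)"
    then obtain y where y: "f x = Suc y" by (cases "f x") auto
    have "num_classes S (f x) = num_classes S y"
      using num_classes_Suc[OF eS, of y] not unfolding y by simp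
    then have "num_classes R (rep x) \<le> num_classes S y" using num_f[of x] by simp
    then have "f x \<le> y" unfolding f_def nth_class_def by (rule Least_le)
    then show False using y by simp
  qed
  have "(x, y) \<in> R \<longleftrightarrow> (f x, f y) \<in> S" for x y
  proof
    assume "(x, y) \<in> R"
    then show "(f x, f y) \<in> S"
      using rep_eq[of x y] eS by (auto simp: f_def equiv_def refl_on_def)
  next
    assume fxy: "(f x, f y) \<in> S"
    then have "(f y, f x) \<in> S" using eS by (auto simp: equiv_def dest: symD)
    with fxy have "f x = f y" using f_first[of x] f_first[of y] by (meson nat_neq_iff)
    then have "num_classes R (rep x) = num_classes R (rep y)" using num_f by metis
    then have "rep x = rep y"
      using num_classes_less[OF eR _ rep_first] by (metis nat_neq_iff)
    then show "(x, y) \<in> R" using rep_eq by simp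
  qed
  moreover have "PR (\<lambda>e. rep (e 0))"
    unfolding rep_def by (rule PR_Least[where b = "\<lambda>e. e 0"]) (intro PRP_rel[OF pR] PR_intros refl)+
  then have "PR (\<lambda>e. nth_class (num_classes R (rep (e 0))))"
    unfolding nth_class_def
  proof (intro PR_Least[where b = "\<lambda>e. h (rep (e 0))"])
    assume prep: "PR (\<lambda>e. rep (e 0))"
    show "PR (\<lambda>e. h (rep (e 0)))" by (rule PR_unary[OF h(1) prep])
    have "PR (\<lambda>e. rep (e (Suc 0)))" using prep PR_proj by (rule PR_subst1)
    then show "PRP (\<lambda>e. num_classes R (rep (e (Suc 0))) \<le> num_classes S (e 0))"
      using cR cS by (intro PR_intros PR_unary[of "num_classes R"] PR_unary[of "num_classes S"])
        (auto simp: class_counter_def)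
  qed (rule h(2))
  then have "primrec_unary f" by (simp add: primrec_unary_iff_PR f_def)
  ultimately show ?thesis unfolding pr_le_def by blast
qed

lemma pr_le_iff_counter_le:
  "punctual R \<Longrightarrow> punctual S \<Longrightarrow> R \<le>\<^sub>p\<^sub>r S \<longleftrightarrow> counter_le (num_classes R) (num_classes S)"
  using pr_le_imp_counter_le counter_le_imp_pr_le by (auto simp: punctual_def)

section \<open>Counters as a lattice\<close>

lemma counter_le_pointwise: "(\<And>s. c s \<le> d s) \<Longrightarrow> counter_le c d"
  unfolding counter_le_def primrec_unary_iff_PR using PR_proj by (intro exI[of _ "\<lambda>s. s"]) auto

lemma counter_le_trans:
  assumes "counter_le a b" "counter_le b c"
  shows "counter_le a c"
proof -
  obtain g h where "primrec_unary g" "\<And>s. a s \<le> b (g s)" "primrec_unary h" "\<And>s. b s \<le> c (h s)"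
    using assms unfolding counter_le_def by blast
  then have "primrec_unary (\<lambda>s. h (g s))" "\<And>s. a s \<le> c (h (g s))"
    by (auto intro: primrec_unary_comp order_trans)
  then show ?thesis unfolding counter_le_def by blast
qed

lemma counter_le_eventually:
  assumes "mono c" "mono d" "\<And>s. m \<le> s \<Longrightarrow> c s \<le> d s"
  shows "counter_le c d"
  unfolding counter_le_def
proof (intro exI[of _ "\<lambda>s. s + m"] conjI allI)
  show "primrec_unary (\<lambda>s. s + m)" unfolding primrec_unary_iff_PR by (intro PR_intros)
  show "c s \<le> d (s + m)" for s
    using monoD[OF assms(1), of s "s + m"] assms(3)[of "s + m"] by simp
qed

text \<open>Two reductions can be replaced by one with the larger bound, because counters are monotone. This is
why minimum and maximum are the lattice operations.\<close>

lemma counter_le_common_bound: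
  assumes "counter_le a c" "counter_le b d" "mono c" "mono d"
  obtains h where "primrec_unary h" "\<And>s. a s \<le> c (h s)" "\<And>s. b s \<le> d (h s)"
proof -
  obtain g g' where g: "primrec_unary g" "\<And>s. a s \<le> c (g s)" "primrec_unary g'" "\<And>s. b s \<le> d (g' s)"
    using assms unfolding counter_le_def by blast
  have "primrec_unary (\<lambda>s. max (g s) (g' s))"
    using g(1,3) unfolding primrec_unary_iff_PR by (rule PR_max)
  moreover have "c (g s) \<le> c (max (g s) (g' s))" "d (g' s) \<le> d (max (g s) (g' s))" for s
    using assms(3,4) by (auto intro: monoD)
  ultimately show thesis using that g(2,4) by (meson order_trans)
qed

lemma counter_le_min:
  assumes "counter_le m c" "counter_le m d" "mono c" "mono d"
  shows "counter_le m (\<lambda>s. min (c s) (d s))"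
proof -
  obtain h where "primrec_unary h" "\<And>s. m s \<le> c (h s)" "\<And>s. m s \<le> d (h s)"
    using counter_le_common_bound[OF assms] by blast
  then show ?thesis unfolding counter_le_def by auto
qed

lemma counter_max_le:
  assumes "counter_le c m" "counter_le d m" "mono m"
  shows "counter_le (\<lambda>s. max (c s) (d s)) m"
proof -
  obtain h where "primrec_unary h" "\<And>s. c s \<le> m (h s)" "\<And>s. d s \<le> m (h s)"
    using counter_le_common_bound[OF assms(1,2,3,3)] by blast
  then show ?thesis unfolding counter_le_def by auto
qed

lemma class_counter_min:
  assumes c: "class_counter c" and d: "class_counter d"
  shows "class_counter (\<lambda>s. min (c s) (d s))"
proof -
  have "\<exists>s. n \<le> min (c s) (d s)" for n
  proof -
    obtain s t where "n \<le> c s" "n \<le> d t" using c d unfolding class_counter_def by blast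
    moreover have "c s \<le> c (max s t)" "d t \<le> d (max s t)"
      using class_counter_mono[OF c] class_counter_mono[OF d] by (auto intro: monoD)
    ultimately have "n \<le> min (c (max s t)) (d (max s t))" by simp
    then show ?thesis ..
  qed
  moreover have "min (c s) (d s) \<le> min (c (Suc s)) (d (Suc s)) \<and>
      min (c (Suc s)) (d (Suc s)) \<le> Suc (min (c s) (d s))" for s
    using class_counter_step[OF c, of s] class_counter_step[OF d, of s] by linarith
  moreover have "primrec_unary (\<lambda>s. min (c s) (d s))"
    using c d unfolding class_counter_def primrec_unary_iff_PR by (auto intro: PR_min)
  ultimately show ?thesis using c d unfolding class_counter_def by auto
qed

lemma class_counter_max:
  assumes c: "class_counter c" and d: "class_counter d"
  shows "class_counter (\<lambda>s. max (c s) (d s))"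
proof -
  have "max (c s) (d s) \<le> max (c (Suc s)) (d (Suc s)) \<and>
      max (c (Suc s)) (d (Suc s)) \<le> Suc (max (c s) (d s))" for s
    using class_counter_step[OF c, of s] class_counter_step[OF d, of s] by linarith
  moreover have "primrec_unary (\<lambda>s. max (c s) (d s))"
    using c d unfolding class_counter_def primrec_unary_iff_PR by (auto intro: PR_max)
  moreover have "\<exists>s. n \<le> max (c s) (d s)" for n
    using c unfolding class_counter_def by (meson max.coboundedI1)
  ultimately show ?thesis using c d unfolding class_counter_def by auto
qed

text \<open>As long as \<open>c < d\<close>, one step can at most make the two values equal.\<close>

lemma counter_le_if_never_meeting:
  assumes c: "class_counter c" and d: "class_counter d"
    and less: "c s < d s" and ne: "\<And>t. s \<le> t \<Longrightarrow> c t \<noteq> d t"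
  shows "counter_le c d"
proof (rule counter_le_eventually[OF class_counter_mono[OF c] class_counter_mono[OF d]])
  fix t
  assume "s \<le> t"
  then have "c t < d t"
  proof (induction rule: dec_induct)
    case (step t)
    then show ?case
      using ne[of "Suc t"] class_counter_step[OF c, of t] class_counter_step[OF d, of t] by linarith
  qed (rule less)
  then show "c t \<le> d t" by simp
qed

lemma incomparable_counters_meet:
  assumes "class_counter c" "class_counter d" "\<not> counter_le c d" "\<not> counter_le d c"
  shows "\<exists>t\<ge>s. c t = d t"
  using counter_le_if_never_meeting[of c d s] counter_le_if_never_meeting[of d c s] assms
  by (metis linorder_neq_iff order_refl)

section \<open>Splitting an interval\<close>

text \<open>The state \<open>(n, w)\<close> at \<open>z\<close> records the number \<open>n\<close> of exchanges so far and the place \<open>w\<close> of the last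
one. The parity of \<open>n\<close> tells which counter currently follows \<open>r\<close>, and \<open>n\<close> is also the level
against which it is diagonalised. An exchange requires a witness that \<open>fgh n\<close> does not reduce \<open>s\<close>
to this counter. As the counter is known to follow \<open>r\<close> only since \<open>w\<close>, the value
\<open>y = fgh n x\<close> must not be smaller than \<open>w\<close>.\<close>

fun stage :: "(nat \<Rightarrow> nat) \<Rightarrow> (nat \<Rightarrow> nat) \<Rightarrow> nat \<Rightarrow> nat \<times> nat" where
  "stage r s 0 = (0, 0)"
| "stage r s (Suc z) = (let (n, w) = stage r s z in
    if r (Suc z) = s (Suc z) \<and>
       (\<exists>x<Suc z. \<exists>y<Suc z. w \<le> y \<and> r y < s x \<and> fgh_halts n x y z)
    then (Suc n, Suc z) else (n, w))"

text \<open>The two values of \<open>b\<close> give complementary counters: at each argument one of them has the value of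
\<open>r\<close> and the other that of \<open>s\<close>.\<close>

definition alternate :: "(nat \<Rightarrow> nat) \<Rightarrow> (nat \<Rightarrow> nat) \<Rightarrow> bool \<Rightarrow> nat \<Rightarrow> nat" where
  "alternate r s b z = (if even (fst (stage r s z)) = b then r z else s z)"

lemma min_alternate: "r z \<le> s z \<Longrightarrow> min (alternate r s True z) (alternate r s False z) = r z"
  and max_alternate: "r z \<le> s z \<Longrightarrow> max (alternate r s True z) (alternate r s False z) = s z"
  by (auto simp: alternate_def)

lemma primrec_unary_alternate:
  assumes r: "primrec_unary r" and s: "primrec_unary s"
  shows "primrec_unary (alternate r s b)"
proof -
  define next_code where "next_code z p = (let n = fst (prod_decode p); w = snd (prod_decode p) in
    if r (Suc z) = s (Suc z) \<and>
       (\<exists>x<Suc z. \<exists>y<Suc z. w \<le> y \<and> r y < s x \<and> fgh_halts n x y z)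
    then prod_encode (Suc n, Suc z) else p)" for z p
  have code_Suc: "prod_encode (stage r s (Suc z)) = next_code z (prod_encode (stage r s z))" for z
  proof -
    obtain n w where stage_z: "stage r s z = (n, w)" by (rule prod.exhaust)
    show ?thesis
      unfolding stage.simps(2) next_code_def prod_encode_inverse stage_z Let_def prod.case
        fst_conv snd_conv
      by (rule if_distrib[of prod_encode])
  qed
  have code: "prod_encode (stage r s z) = rec_nat (prod_encode (0, 0)) next_code z" for z
    by (induction z) (simp_all add: code_Suc del: stage.simps(2))
  have "PR (\<lambda>e. next_code (e 0) (e 1))"
    unfolding next_code_def Let_def
    by (intro PR_intros PR_unary[OF r] PR_unary[OF s] PR_pair PR_fst PR_snd PRP_fgh_halts)
  then have "PR (\<lambda>e. prod_encode (stage r s (e 0)))"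
    unfolding code by (intro PR_rec[where g = "\<lambda>k r e. next_code k r"] PR_intros)
  from PR_fst[OF this] have "PR (\<lambda>e. fst (stage r s (e 0)))" by simp
  then show ?thesis
    unfolding primrec_unary_iff_PR alternate_def
    by (cases b) (auto intro!: PR_intros PRP_even PR_unary[OF r] PR_unary[OF s])
qed

text \<open>Exchanges happen only where \<open>r\<close> and \<open>s\<close> agree, which keeps the increments of the alternating
counters at \<open>0\<close> or \<open>1\<close>.\<close>

lemma stage_step:
  "fst (stage r s (Suc z)) = fst (stage r s z) \<or>
   fst (stage r s (Suc z)) = Suc (fst (stage r s z)) \<and> r (Suc z) = s (Suc z)"
  by (auto simp: Let_def split_beta)

lemma stage_since:
  "snd (stage r s z) \<le> y \<Longrightarrow> y \<le> z \<Longrightarrow> fst (stage r s y) = fst (stage r s z)"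
proof (induction z)
  case (Suc z)
  show ?case
  proof (cases "y = Suc z")
    case False
    moreover have "stage r s (Suc z) = stage r s z \<or> snd (stage r s (Suc z)) = Suc z"
    proof -
      have if_cases: "(if c then (k, i) else p) = p \<or> snd (if c then (k, i) else p) = i"
        for c and k i :: nat and p by simp
      obtain n w where stage_z: "stage r s z = (n, w)" by (rule prod.exhaust)
      show ?thesis unfolding stage.simps(2) stage_z Let_def prod.case by (rule if_cases)
    qed
    ultimately have "stage r s (Suc z) = stage r s z" using Suc.prems by (metis le_antisym)
    then show ?thesis using Suc False by simp
  qed simp
qed simp

context
  fixes r s :: "nat \<Rightarrow> nat"
  assumes r: "class_counter r" and s: "class_counter s"
    and le: "\<And>z. r z \<le> s z"
    and meet: "\<And>z. \<exists>t\<ge>z. r t = s t"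
begin

lemma class_counter_alternate: "class_counter (alternate r s b)"
  unfolding class_counter_def
proof (intro conjI allI)
  show "primrec_unary (alternate r s b)"
    using r s by (intro primrec_unary_alternate) (auto simp: class_counter_def)
  show "alternate r s b 0 = 1" using r s by (simp add: alternate_def class_counter_def)
  fix z
  have between: "r z \<le> alternate r s b z" "alternate r s b z \<le> s z" for z
    using le by (auto simp: alternate_def)
  show "alternate r s b z \<le> alternate r s b (Suc z)"
    and "alternate r s b (Suc z) \<le> Suc (alternate r s b z)"
    using stage_step[of r s z] class_counter_step[OF r, of z] class_counter_step[OF s, of z]
      between[of z] between[of "Suc z"] le[of z]
    by (auto simp: alternate_def simp del: stage.simps)
  show "\<exists>t. z \<le> alternate r s b t"
    using r between(1) unfolding class_counter_def by (meson le_trans)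
qed

text \<open>If there were no further exchange after \<open>z0\<close>, level \<open>n\<close> and place \<open>w\<close> would stay fixed. Since
\<open>fgh n\<close> is primitive recursive, it does not reduce \<open>s\<close> to \<open>r\<close>, which gives a witness \<open>x\<close>;
the next agreement of \<open>r\<close> and \<open>s\<close> after the machine has halted on it triggers an exchange.\<close>

lemma stage_advances:
  assumes not_le: "\<not> counter_le s r"
  shows "\<exists>z. fst (stage r s z) = n"
proof (induction n)
  case 0
  show ?case by (rule exI[of _ 0]) simp
next
  case (Suc n)
  then obtain z0 where z0: "fst (stage r s z0) = n" by blast
  show ?case
  proof (rule ccontr)
    assume never: "\<nexists>z. fst (stage r s z) = Suc n"
    define w where "w = snd (stage r s z0)"
    have stuck: "stage r s z = (n, w)" if "z0 \<le> z" for z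
      using that
    proof (induction rule: dec_induct)
      case base
      show ?case using z0 by (simp add: w_def prod_eq_iff)
    next
      case (step z)
      then show ?case using spec[OF never[unfolded not_ex], of "Suc z"]
        by (auto simp: Let_def split: if_splits)
    qed
    define m where "m = max z0 w"
    \<comment> \<open>Raising the bound to \<open>c\<close> excludes witnesses \<open>x \<le> m\<close>, so that \<open>y > x\<close> lies beyond \<open>w\<close>.\<close>
    obtain c where c: "s m \<le> r c" using r unfolding class_counter_def by blast
    have "primrec_unary (\<lambda>x. max (fgh n x) c)"
      using primrec_unary_fgh[of n] unfolding primrec_unary_iff_PR by (intro PR_max PR_const)
    then obtain x where x: "r (max (fgh n x) c) < s x"
      using not_le unfolding counter_le_def by (meson not_le_imp_less)
    define y where "y = fgh n x"
    have "r y \<le> r (max y c)" "r c \<le> r (max y c)"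
      using class_counter_mono[OF r] by (auto intro: monoD)
    with x c have ry: "r y < s x" and "s m < s x" by (auto simp: y_def)
    then have "m < x" using monoD[OF class_counter_mono[OF s], of x m] by fastforce
    moreover have "x < y" unfolding y_def by (rule fgh_greater)
    moreover obtain t where "fgh_halts n x y t"
      unfolding y_def fgh_halts_def using fgh_step_reaches by blast
    moreover obtain z' where "Suc (max y t) \<le> z'" "r z' = s z'" using meet by blast
    ultimately obtain z where z: "max y t \<le> z" "r (Suc z) = s (Suc z)" "fgh_halts n x y z"
      "x < Suc z" "y < Suc z" "w \<le> y" "z0 \<le> z"
      using fgh_halts_later by (cases z') (auto simp: m_def)
    then have "fst (stage r s (Suc z)) = Suc n"
      using stuck[of z] ry by (auto simp: Let_def)
    then show False using never by blast
  qed
qed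

text \<open>The witness that caused the exchange from \<open>n\<close> to \<open>n + 1\<close> was valid for the phase numbered \<open>n\<close>.\<close>

lemma stage_witness:
  assumes "\<not> counter_le s r"
  obtains x where "fst (stage r s (fgh n x)) = n" "r (fgh n x) < s x"
proof -
  define z where "z = (LEAST z. fst (stage r s z) = Suc n)"
  have z: "fst (stage r s z) = Suc n"
    unfolding z_def using stage_advances[OF assms] by (rule LeastI_ex)
  then obtain z' where z': "z = Suc z'" by (cases z) auto
  then have "fst (stage r s z') \<noteq> Suc n"
    using not_less_Least[of z' "\<lambda>z. fst (stage r s z) = Suc n"] by (auto simp: z_def)
  with z have "fst (stage r s z') = n \<and> (\<exists>x<z. \<exists>y<z. snd (stage r s z') \<le> y \<and> r y < s x \<and> fgh_halts n x y z')"
    unfolding z' by (auto simp: Let_def split_beta split: if_splits)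
  then obtain x y where xy: "fst (stage r s z') = n" "y < z" "snd (stage r s z') \<le> y"
      "r y < s x" "fgh_halts n x y z'" by blast
  moreover have "y = fgh n x" using xy(5) by (rule fgh_halts_value)
  moreover have "fst (stage r s y) = n" using stage_since[of r s z' y] xy z' by simp
  ultimately show thesis using that by blast
qed

text \<open>Every bound \<open>h\<close> is below some \<open>fgh k\<close>, hence below \<open>fgh n\<close> for all \<open>n \<ge> k\<close>. Among these
there is an \<open>n\<close> of the parity for which the counter equals \<open>r\<close> during phase \<open>n\<close>, and the witness of
that phase refutes \<open>h\<close>.\<close>

lemma alternate_not_above:
  assumes "\<not> counter_le s r"
  shows "\<not> counter_le s (alternate r s b)"
proof
  assume "counter_le s (alternate r s b)"
  then obtain h where h: "primrec_unary h" "\<And>x. s x \<le> alternate r s b (h x)"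
    unfolding counter_le_def by blast
  obtain k where k: "\<And>x. h x \<le> fgh k x" using fgh_dominates[OF h(1)] by blast
  define n where "n = (if b then 2 * k else Suc (2 * k))"
  have n: "k \<le> n" "even n = b" by (auto simp: n_def)
  obtain x where x: "fst (stage r s (fgh n x)) = n" "r (fgh n x) < s x"
    using stage_witness[OF assms] by blast
  have "h x \<le> fgh n x" using k[of x] fgh_level_mono[OF n(1), of x] by simp
  then have "alternate r s b (h x) \<le> alternate r s b (fgh n x)"
    by (rule monoD[OF class_counter_mono[OF class_counter_alternate]])
  also have "\<dots> = r (fgh n x)" using x(1) n(2) by (simp add: alternate_def)
  finally show False using h(2)[of x] x(2) by simp
qed

end

section \<open>Sets and their relations\<close>

lemma equiv_set_rel: "equiv UNIV (set_rel X)"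
  by (auto simp: set_rel_def equiv_def refl_on_def sym_def trans_def)

lemma punctual_set_rel:
  assumes "primrec_set X" "infinite (- X)"
  shows "punctual (set_rel X)"
  unfolding punctual_def
proof (intro conjI equiv_set_rel)
  show "primrec_rel (set_rel X)"
    unfolding primrec_rel_iff_PRP set_rel_def using assms(1)
    by (auto intro!: PR_intros PRP_set)
  have "inj_on (\<lambda>i. set_rel X `` {i}) (- X)"
    by (auto simp: inj_on_def set_rel_def)
  then have "infinite ((\<lambda>i. set_rel X `` {i}) ` (- X))"
    using assms(2) finite_imageD by blast
  moreover have "(\<lambda>i. set_rel X `` {i}) ` (- X) \<subseteq> UNIV // set_rel X"
    by (auto intro: quotientI)
  ultimately show "infinite (UNIV // set_rel X)" using finite_subset by blast
qed

text \<open>The elements outside \<open>X\<close> are singleton classes, and \<open>X\<close> itself adds one class from its least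
element on.\<close>

lemma num_classes_set_rel:
  "num_classes (set_rel X) s = count_zeros X s + of_bool (\<exists>i\<le>s. i \<in> X)"
proof (induction s)
  case 0
  have "{i. i \<le> 0 \<and> i \<notin> X} = (if 0 \<in> X then {} else {0})" by (auto intro: gr0I)
  then show ?case by (simp add: num_classes_def count_zeros_def)
next
  case (Suc s)
  have "{i. i \<le> Suc s \<and> i \<notin> X}
      = (if Suc s \<in> X then {i. i \<le> s \<and> i \<notin> X} else insert (Suc s) {i. i \<le> s \<and> i \<notin> X})"
    by (auto simp: le_Suc_eq)
  then have "count_zeros X (Suc s) = count_zeros X s + of_bool (Suc s \<notin> X)"
    by (simp add: count_zeros_def)
  moreover have "(\<forall>j<Suc s. (j, Suc s) \<notin> set_rel X) \<longleftrightarrow> Suc s \<notin> X \<or> \<not> (\<exists>i\<le>s. i \<in> X)"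
    by (auto simp: set_rel_def less_Suc_eq_le)
  moreover have "(\<exists>i\<le>Suc s. i \<in> X) \<longleftrightarrow> (\<exists>i\<le>s. i \<in> X) \<or> Suc s \<in> X"
    by (auto simp: le_Suc_eq)
  ultimately show ?case
    unfolding num_classes_Suc[OF equiv_set_rel] Suc by auto
qed

text \<open>The places where \<open>c\<close> does not grow. Putting \<open>0\<close> into the set makes the class of \<open>plateaus c\<close> the
one that \<open>c 0 = 1\<close> counts, and then \<open>c\<close> is exactly the class counter of
\<open>set_rel (plateaus c)\<close>.\<close>

definition plateaus :: "(nat \<Rightarrow> nat) \<Rightarrow> nat set" where
  "plateaus c = {x. x = 0 \<or> c x = c (x - 1)}"

lemma primrec_set_plateaus:
  assumes "primrec_unary c"
  shows "primrec_set (plateaus c)"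
  unfolding primrec_set_iff_PRP plateaus_def mem_Collect_eq
  by (intro PR_intros PR_unary[OF assms])

lemma num_classes_plateaus:
  assumes "class_counter c"
  shows "num_classes (set_rel (plateaus c)) = c"
proof
  show "num_classes (set_rel (plateaus c)) s = c s" for s
  proof (induction s)
    case 0
    show ?case using assms by (simp add: class_counter_def num_classes_def)
  next
    case (Suc s)
    have "(\<forall>j<Suc s. (j, Suc s) \<notin> set_rel (plateaus c)) \<longleftrightarrow> Suc s \<notin> plateaus c"
      by (auto simp: set_rel_def) (auto simp: plateaus_def)
    moreover have "c (Suc s) = c s + of_bool (Suc s \<notin> plateaus c)"
      using class_counter_step[OF assms, of s] by (auto simp: plateaus_def)
    ultimately show ?case unfolding num_classes_Suc[OF equiv_set_rel] Suc by simp
  qed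
qed

lemma count_zeros_plateaus:
  assumes "class_counter c"
  shows "Suc (count_zeros (plateaus c) s) = c s"
  using num_classes_plateaus[OF assms] num_classes_set_rel[of "plateaus c" s]
  by (auto simp: plateaus_def)

lemma infinite_not_plateaus:
  assumes "class_counter c"
  shows "infinite (- plateaus c)"
proof
  assume fin: "finite (- plateaus c)"
  obtain s where s: "card (- plateaus c) + 2 \<le> c s" using assms unfolding class_counter_def by blast
  have "count_zeros (plateaus c) s \<le> card (- plateaus c)"
    unfolding count_zeros_def using fin by (intro card_mono) auto
  then show False using count_zeros_plateaus[OF assms, of s] s by simp
qed

lemma punctual_set_rel_plateaus: "class_counter c \<Longrightarrow> punctual (set_rel (plateaus c))"
  by (intro punctual_set_rel primrec_set_plateaus infinite_not_plateaus) (simp_all add: class_counter_def)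

text \<open>Taking every value twice does not change the degree, but it creates infinitely many plateaus.\<close>

lemma class_counter_slow:
  assumes "class_counter c"
  shows "class_counter (\<lambda>s. c (s div 2))"
  unfolding class_counter_def
proof (intro conjI allI)
  have "primrec_unary c" using assms by (simp add: class_counter_def)
  then show "primrec_unary (\<lambda>s. c (s div 2))"
    unfolding primrec_unary_iff_PR[of "\<lambda>s. c (s div 2)"] by (rule PR_unary) (intro PR_half PR_proj)
  show "c (0 div 2) = 1" using assms by (simp add: class_counter_def)
  fix s
  have "Suc s div 2 = s div 2 \<or> Suc s div 2 = Suc (s div 2)" by presburger
  then show "c (s div 2) \<le> c (Suc s div 2)" "c (Suc s div 2) \<le> Suc (c (s div 2))"
    using class_counter_step[OF assms, of "s div 2"] by auto
  obtain t where "s \<le> c t" using assms unfolding class_counter_def by blast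
  then have "s \<le> c ((2 * t) div 2)" by simp
  then show "\<exists>t. s \<le> c (t div 2)" by blast
qed

lemma infinite_plateaus_slow: "infinite (plateaus (\<lambda>s. c (s div 2)))"
proof -
  have "Suc (2 * k) \<in> plateaus (\<lambda>s. c (s div 2))" for k by (simp add: plateaus_def)
  then have "(\<lambda>k. Suc (2 * k)) ` UNIV \<subseteq> plateaus (\<lambda>s. c (s div 2))" by blast
  moreover have "infinite (range (\<lambda>k::nat. Suc (2 * k)))"
    by (simp add: finite_image_iff inj_on_def)
  ultimately show ?thesis using finite_subset by blast
qed

lemma counter_le_slow: "counter_le c (\<lambda>s. c (s div 2))"
  unfolding counter_le_def
proof (intro exI[of _ "\<lambda>s. 2 * s"] conjI allI)
  show "primrec_unary (\<lambda>s. 2 * s)" unfolding primrec_unary_iff_PR by (intro PR_intros)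
qed simp

lemma slow_counter_le: "class_counter c \<Longrightarrow> counter_le (\<lambda>s. c (s div 2)) c"
  by (rule counter_le_pointwise) (simp add: monoD[OF class_counter_mono])

section \<open>The diamond\<close>

lemma is_meet_iff:
  assumes "m \<in> carrier L" "a \<in> carrier L" "b \<in> carrier L"
  shows "is_meet L m a b \<longleftrightarrow> m \<sqsubseteq>\<^bsub>L\<^esub> a \<and> m \<sqsubseteq>\<^bsub>L\<^esub> b \<and>
    (\<forall>x\<in>carrier L. x \<sqsubseteq>\<^bsub>L\<^esub> a \<longrightarrow> x \<sqsubseteq>\<^bsub>L\<^esub> b \<longrightarrow> x \<sqsubseteq>\<^bsub>L\<^esub> m)"
  using assms unfolding is_meet_def greatest_def Lower_def by blast

lemma is_join_iff:
  assumes "j \<in> carrier L" "a \<in> carrier L" "b \<in> carrier L"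
  shows "is_join L j a b \<longleftrightarrow> a \<sqsubseteq>\<^bsub>L\<^esub> j \<and> b \<sqsubseteq>\<^bsub>L\<^esub> j \<and>
    (\<forall>x\<in>carrier L. a \<sqsubseteq>\<^bsub>L\<^esub> x \<longrightarrow> b \<sqsubseteq>\<^bsub>L\<^esub> x \<longrightarrow> j \<sqsubseteq>\<^bsub>L\<^esub> x)"
  using assms unfolding is_join_def least_def Upper_def by blast

lemma pr_degree_in_carrier: "punctual R \<Longrightarrow> pr_degree R \<in> carrier Peq"
  by (simp add: carrier_Peq)

lemma ball_carrier_Peq: "(\<forall>a\<in>carrier Peq. P a) \<longleftrightarrow> (\<forall>R. punctual R \<longrightarrow> P (pr_degree R))"
  by (simp add: carrier_Peq)

lemma is_meet_Peq_iff:
  assumes "punctual R" "punctual T" "punctual U"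
  shows "is_meet Peq (pr_degree R) (pr_degree T) (pr_degree U) \<longleftrightarrow>
    R \<le>\<^sub>p\<^sub>r T \<and> R \<le>\<^sub>p\<^sub>r U \<and> (\<forall>M. punctual M \<longrightarrow> M \<le>\<^sub>p\<^sub>r T \<longrightarrow> M \<le>\<^sub>p\<^sub>r U \<longrightarrow> M \<le>\<^sub>p\<^sub>r R)"
  using assms
  by (simp add: is_meet_iff pr_degree_in_carrier ball_carrier_Peq Peq_le_iff cong: imp_cong)

lemma is_join_Peq_iff:
  assumes "punctual S" "punctual T" "punctual U"
  shows "is_join Peq (pr_degree S) (pr_degree T) (pr_degree U) \<longleftrightarrow>
    T \<le>\<^sub>p\<^sub>r S \<and> U \<le>\<^sub>p\<^sub>r S \<and> (\<forall>M. punctual M \<longrightarrow> T \<le>\<^sub>p\<^sub>r M \<longrightarrow> U \<le>\<^sub>p\<^sub>r M \<longrightarrow> S \<le>\<^sub>p\<^sub>r M)"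
  using assms
  by (simp add: is_join_iff pr_degree_in_carrier ball_carrier_Peq Peq_le_iff cong: imp_cong)

text \<open>The minimum of the two counters is itself the counter of a punctual relation, so it represents the
greatest lower bound.\<close>

lemma is_meet_iff_min:
  assumes R: "punctual R" and T: "punctual T" and U: "punctual U"
  defines "m \<equiv> (\<lambda>s. min (num_classes T s) (num_classes U s))"
  shows "is_meet Peq (pr_degree R) (pr_degree T) (pr_degree U) \<longleftrightarrow>
    counter_le (num_classes R) m \<and> counter_le m (num_classes R)"
proof -
  have cT: "class_counter (num_classes T)" and cU: "class_counter (num_classes U)"
    using T U by (auto intro: class_counter_num_classes)
  then have m: "class_counter m" unfolding m_def by (rule class_counter_min)
  let ?M = "set_rel (plateaus m)"
  have M: "punctual ?M" "num_classes ?M = m"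
    using punctual_set_rel_plateaus[OF m] num_classes_plateaus[OF m] by auto
  have below: "counter_le c m \<longleftrightarrow> counter_le c (num_classes T) \<and> counter_le c (num_classes U)" for c
  proof
    assume "counter_le c m"
    moreover have "counter_le m (num_classes T)" "counter_le m (num_classes U)"
      by (auto intro!: counter_le_pointwise simp: m_def)
    ultimately show "counter_le c (num_classes T) \<and> counter_le c (num_classes U)"
      using counter_le_trans by blast
  next
    assume "counter_le c (num_classes T) \<and> counter_le c (num_classes U)"
    then show "counter_le c m"
      unfolding m_def using cT cU by (intro counter_le_min class_counter_mono) auto
  qed
  have m_refl: "counter_le m m" by (rule counter_le_pointwise) simp
  have "is_meet Peq (pr_degree R) (pr_degree T) (pr_degree U) \<longleftrightarrow>
      counter_le (num_classes R) m \<and>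
      (\<forall>V. punctual V \<longrightarrow> counter_le (num_classes V) m \<longrightarrow> counter_le (num_classes V) (num_classes R))"
    by (simp add: is_meet_Peq_iff below pr_le_iff_counter_le R T U imp_conjL)
  also have "\<dots> \<longleftrightarrow> counter_le (num_classes R) m \<and> counter_le m (num_classes R)"
    using M m_refl counter_le_trans by metis
  finally show ?thesis .
qed

lemma is_join_iff_max:
  assumes S: "punctual S" and T: "punctual T" and U: "punctual U"
  defines "m \<equiv> (\<lambda>s. max (num_classes T s) (num_classes U s))"
  shows "is_join Peq (pr_degree S) (pr_degree T) (pr_degree U) \<longleftrightarrow>
    counter_le (num_classes S) m \<and> counter_le m (num_classes S)"
proof -
  have cT: "class_counter (num_classes T)" and cU: "class_counter (num_classes U)"
    using T U by (auto intro: class_counter_num_classes)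
  then have m: "class_counter m" unfolding m_def by (rule class_counter_max)
  let ?M = "set_rel (plateaus m)"
  have M: "punctual ?M" "num_classes ?M = m"
    using punctual_set_rel_plateaus[OF m] num_classes_plateaus[OF m] by auto
  have above: "counter_le m (num_classes V) \<longleftrightarrow>
      counter_le (num_classes T) (num_classes V) \<and> counter_le (num_classes U) (num_classes V)"
    if "punctual V" for V
  proof
    assume "counter_le m (num_classes V)"
    moreover have "counter_le (num_classes T) m" "counter_le (num_classes U) m"
      by (auto intro!: counter_le_pointwise simp: m_def)
    ultimately show "counter_le (num_classes T) (num_classes V) \<and> counter_le (num_classes U) (num_classes V)"
      using counter_le_trans by blast
  next
    assume "counter_le (num_classes T) (num_classes V) \<and> counter_le (num_classes U) (num_classes V)"
    then show "counter_le m (num_classes V)"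
      unfolding m_def using class_counter_mono[OF class_counter_num_classes[OF that]]
      by (intro counter_max_le) auto
  qed
  have m_refl: "counter_le m m" by (rule counter_le_pointwise) simp
  have "is_join Peq (pr_degree S) (pr_degree T) (pr_degree U) \<longleftrightarrow>
      counter_le m (num_classes S) \<and>
      (\<forall>V. punctual V \<longrightarrow> counter_le m (num_classes V) \<longrightarrow> counter_le (num_classes S) (num_classes V))"
    by (simp add: is_join_Peq_iff above pr_le_iff_counter_le S T U imp_conjL)
  also have "\<dots> \<longleftrightarrow> counter_le (num_classes S) m \<and> counter_le m (num_classes S)"
    using M m_refl counter_le_trans by metis
  finally show ?thesis .
qed

text \<open>The sets are the plateaus of the minimum and of the maximum of the two middle counters, slowed down
to make the sets infinite.\<close>

lemma diamond_imp_black_lozenge: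
  assumes R: "punctual R" and S: "punctual S" and "embeds_diamond_preserving_0_1 R S"
  shows "black_lozenge R S"
proof -
  obtain T U where T: "punctual T" and U: "punctual U"
    and less: "T <\<^sub>p\<^sub>r S" "U <\<^sub>p\<^sub>r S"
    and meet: "is_meet Peq (pr_degree R) (pr_degree T) (pr_degree U)"
    and join: "is_join Peq (pr_degree S) (pr_degree T) (pr_degree U)"
    using assms(3) unfolding embeds_diamond_preserving_0_1_def by blast
  let ?t = "num_classes T" and ?u = "num_classes U"
  have t: "class_counter ?t" and u: "class_counter ?u"
    using T U by (auto intro: class_counter_num_classes)
  have "\<not> T \<le>\<^sub>p\<^sub>r U" "\<not> U \<le>\<^sub>p\<^sub>r T"
    using join less pr_le_refl T U unfolding is_join_Peq_iff[OF S T U] pr_less_def by blast+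
  then have agree: "\<exists>z\<ge>n. ?t z = ?u z" for n
    using incomparable_counters_meet[OF t u] by (simp add: pr_le_iff_counter_le T U)
  let ?m = "\<lambda>z. min (?t z) (?u z)" and ?j = "\<lambda>z. max (?t z) (?u z)"
  define m where "m z = ?m (z div 2)" for z
  define j where "j z = ?j (z div 2)" for z
  have cm: "class_counter ?m" and cj: "class_counter ?j"
    using t u by (auto intro: class_counter_min class_counter_max)
  have m: "class_counter m" and j: "class_counter j"
    unfolding m_def j_def using class_counter_slow[OF cm] class_counter_slow[OF cj] by simp_all
  have inf: "infinite (plateaus m)" "infinite (plateaus j)"
    unfolding m_def j_def using infinite_plateaus_slow[of ?m] infinite_plateaus_slow[of ?j] by simp_all
  have "counter_le ?m m" "counter_le m ?m" "counter_le ?j j" "counter_le j ?j"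
    unfolding m_def j_def using counter_le_slow[of ?m] slow_counter_le[OF cm]
      counter_le_slow[of ?j] slow_counter_le[OF cj] by simp_all
  then have "counter_le (num_classes R) m" "counter_le m (num_classes R)"
    "counter_le (num_classes S) j" "counter_le j (num_classes S)"
    using meet join counter_le_trans unfolding is_meet_iff_min[OF R T U] is_join_iff_max[OF S T U]
    by blast+
  then have "set_rel (plateaus m) \<equiv>\<^sub>p\<^sub>r R" "set_rel (plateaus j) \<equiv>\<^sub>p\<^sub>r S"
    using punctual_set_rel_plateaus m j R S num_classes_plateaus[OF m] num_classes_plateaus[OF j]
    by (auto simp: pr_equiv_def pr_le_iff_counter_le)
  moreover have "\<exists>z\<ge>n. count_zeros (plateaus m) z = count_zeros (plateaus j) z" for n
  proof -
    obtain z where "n \<le> z" "?t z = ?u z" using agree by blast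
    then have "m (2 * z) = j (2 * z)" "n \<le> 2 * z" by (simp_all add: m_def j_def)
    then show ?thesis
      using count_zeros_plateaus[OF m, of "2 * z"] count_zeros_plateaus[OF j, of "2 * z"] by auto
  qed
  moreover have "primrec_set (plateaus m)" "primrec_set (plateaus j)"
    using m j by (auto intro: primrec_set_plateaus simp: class_counter_def)
  ultimately show ?thesis
    unfolding black_lozenge_def using inf infinite_not_plateaus[OF m] infinite_not_plateaus[OF j]
    by blast
qed

text \<open>The counters of the two given sets are comparable only up to a primitive recursive bound. Their
minimum and maximum have the same degrees and are comparable pointwise, as the alternation requires.\<close>

lemma black_lozenge_imp_diamond:
  assumes R: "punctual R" and S: "punctual S" and "R <\<^sub>p\<^sub>r S" and "black_lozenge R S"
  shows "embeds_diamond_preserving_0_1 R S"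
proof -
  obtain X Y where X: "primrec_set X" "infinite X" "infinite (- X)"
    and Y: "primrec_set Y" "infinite Y" "infinite (- Y)"
    and XR: "set_rel X \<equiv>\<^sub>p\<^sub>r R" and YS: "set_rel Y \<equiv>\<^sub>p\<^sub>r S"
    and agree: "\<And>n. \<exists>t\<ge>n. count_zeros X t = count_zeros Y t"
    using assms(4) unfolding black_lozenge_def by blast
  let ?x = "num_classes (set_rel X)" and ?y = "num_classes (set_rel Y)"
  have pX: "punctual (set_rel X)" and pY: "punctual (set_rel Y)"
    using X Y by (auto intro: punctual_set_rel)
  have x: "class_counter ?x" and y: "class_counter ?y"
    using pX pY by (auto intro: class_counter_num_classes)
  define r where "r z = min (?x z) (?y z)" for z
  define s where "s z = max (?x z) (?y z)" for z
  have r: "class_counter r" and s: "class_counter s"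
    unfolding r_def s_def using x y by (auto intro: class_counter_min class_counter_max)
  have le: "r z \<le> s z" for z by (simp add: r_def s_def)
  have agree': "\<exists>t\<ge>n. r t = s t" for n
  proof -
    \<comment> \<open>Past the first elements of both sets, the two class counts exceed the zero counts by \<open>1\<close>.\<close>
    obtain i k where "i \<in> X" "k \<in> Y" using X(2) Y(2) by fastforce
    moreover obtain t where t: "max n (max i k) \<le> t" "count_zeros X t = count_zeros Y t"
      using agree by blast
    ultimately have "(\<exists>i\<le>t. i \<in> X) \<and> (\<exists>i\<le>t. i \<in> Y)" by auto
    then have "?x t = ?y t" unfolding num_classes_set_rel using t(2) by simp
    then show ?thesis using t(1) by (auto simp: r_def s_def)
  qed
  have "set_rel X \<le>\<^sub>p\<^sub>r set_rel Y"
    using XR YS assms(3) pr_le_trans unfolding pr_equiv_def pr_less_def by blast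
  then have xy: "counter_le ?x ?y" by (simp add: pr_le_iff_counter_le pX pY)
  have refl: "counter_le c c" for c by (rule counter_le_pointwise) simp
  have "counter_le r ?x" "counter_le ?y s"
    by (auto intro!: counter_le_pointwise simp: r_def s_def)
  moreover have "counter_le ?x r" "counter_le s ?y"
    unfolding r_def s_def using xy refl x y
    by (auto intro!: counter_le_min counter_max_le class_counter_mono)
  moreover have "counter_le (num_classes R) ?x" "counter_le ?x (num_classes R)"
    "counter_le (num_classes S) ?y" "counter_le ?y (num_classes S)"
    using XR YS by (simp_all add: pr_equiv_def pr_le_iff_counter_le R S pX pY)
  ultimately have Rr: "counter_le (num_classes R) r" "counter_le r (num_classes R)"
    and Ss: "counter_le (num_classes S) s" "counter_le s (num_classes S)"
    using counter_le_trans by blast+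
  have "\<not> counter_le (num_classes S) (num_classes R)"
    using assms(3) by (simp add: pr_less_def pr_le_iff_counter_le R S)
  then have not_sr: "\<not> counter_le s r" using Rr Ss counter_le_trans by blast
  define t where "t = alternate r s"
  have t: "class_counter (t b)" for b
    unfolding t_def using class_counter_alternate[OF r s le agree'] .
  have s_t: "\<not> counter_le s (t b)" for b
    unfolding t_def using alternate_not_above[OF r s le agree' not_sr] .
  have min_t: "(\<lambda>z. min (t True z) (t False z)) = r" and max_t: "(\<lambda>z. max (t True z) (t False z)) = s"
    using min_alternate max_alternate le by (auto simp: t_def)
  have t_between: "r z \<le> t b z" "t b z \<le> s z" for b z
    using le by (auto simp: t_def alternate_def)
  define T where "T b = set_rel (plateaus (t b))" for b
  have T: "punctual (T b)" and num_T: "num_classes (T b) = t b" for b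
    using punctual_set_rel_plateaus[OF t] num_classes_plateaus[OF t] by (auto simp: T_def)
  have r_t: "counter_le r (t b)" and t_s: "counter_le (t b) s" for b
    using t_between by (auto intro: counter_le_pointwise)
  have t_r: "\<not> counter_le (t b) r" for b
  proof
    \<comment> \<open>Then \<open>t b\<close> would be below its partner, and so would be their maximum \<open>s\<close>.\<close>
    assume "counter_le (t b) r"
    then have "counter_le (t b) (t (\<not> b))" using r_t counter_le_trans by blast
    then have "counter_le (\<lambda>z. max (t b z) (t (\<not> b) z)) (t (\<not> b))"
      using refl t by (intro counter_max_le class_counter_mono)
    moreover have "(\<lambda>z. max (t b z) (t (\<not> b) z)) = s"
      using max_t by (cases b) (auto simp: max.commute)
    ultimately show False using s_t by metis
  qed
  have less: "R <\<^sub>p\<^sub>r T b" "T b <\<^sub>p\<^sub>r S" for b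
    using r_t[of b] t_r[of b] t_s[of b] s_t[of b] Rr Ss counter_le_trans
    unfolding pr_less_def pr_le_iff_counter_le[OF R T] pr_le_iff_counter_le[OF T R]
      pr_le_iff_counter_le[OF S T] pr_le_iff_counter_le[OF T S] num_T
    by blast+
  moreover have "is_meet Peq (pr_degree R) (pr_degree (T True)) (pr_degree (T False))"
    unfolding is_meet_iff_min[OF R T T] num_T min_t using Rr by blast
  moreover have "is_join Peq (pr_degree S) (pr_degree (T True)) (pr_degree (T False))"
    unfolding is_join_iff_max[OF S T T] num_T max_t using Ss by blast
  ultimately show ?thesis
    unfolding embeds_diamond_preserving_0_1_def using T by blast
qed

theorem corollary8p7:
  fixes R S :: "nat rel"
  assumes "punctual R" and "punctual S" and "R <\<^sub>p\<^sub>r S"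
  shows "embeds_diamond_preserving_0_1 R S \<longleftrightarrow> black_lozenge R S"
  using diamond_imp_black_lozenge[OF assms(1,2)] black_lozenge_imp_diamond[OF assms] by blast

end
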